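(* Let $\kappa$ be a field of characteristic zero and $\rho:W_F\to GL_n(\kappa)$ a semisimple smooth representation which is tamely ramified (trivial on $P_F$). Let $\sigma=\rho(s)$, where $s\in I_F$ maps to a topological generator of $I_F/P_F$, and write $\mathrm{Fr}$ also for $\rho(\mathrm{Fr})$. Then $$\det(1+\sigma+\dots+\sigma^{q-1})=q^{\dim\rho^{I_F}}$$ and $$\frac{\mathrm{Char}(\mathrm{Fr})(X)}{\mathrm{Char}\big((1+\sigma+\dots+\sigma^{q-1})\mathrm{Fr}\big)(X)}=\frac{L(\rho,qX)}{L(\rho,X)}.$$
   Context: $F$ is a finite extension of $\mathbb{Q}_p$ with residue field of order $q$; $W_F$ its Weil group, $I_F$ inertia, $P_F$ wild inertia, $\mathrm{Fr}$ a geometric Frobenius. Smooth means continuous for the discrete topology on $\kappa$. $L(\rho,X)=\det(1-\mathrm{Fr}X\mid\rho^{I_F})^{-1}$. For an $n\times n$ matrix $A$, $\mathrm{Char}(A)(X)$ denotes $\det(I-XA)$. *)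

theory Defs
  imports
    "HOL-Analysis.Abstract_Topology"
    "HOL-Algebra.Algebraic_Closure"
    "HOL-Algebra.Coset"
    "HOL-Algebra.Generated_Groups"
    "HOL-Computational_Algebra.Fraction_Field"
    "Jordan_Normal_Form.VS_Connect"
begin

section \<open>p-adic fields inside an algebraic closure\<close>

definition padic_abs :: "nat \<Rightarrow> rat \<Rightarrow> real" where
  "padic_abs p r = (if r = 0 then 0
     else real p powi (int (multiplicity (int p) (snd (quotient_of r)))
                       - int (multiplicity (int p) (fst (quotient_of r)))))"

text \<open>
  The type \<open>'a\<close> is an algebraic closure of \<open>F\<close>, and \<open>v\<close> is the absolute value on it extending
  the \<open>p\<close>-adic one (it exists and is unique; it is part of the data only so that valuation
  rings can be named).  \<open>Qp\<close> is characterised as the completion of the rationals for the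
  \<open>p\<close>-adic absolute value: a complete subfield in which they are dense.
\<close>

locale padic_field_in_closure =
  fixes p :: nat and v :: "'a::field_char_0 \<Rightarrow> real" and Qp F :: "'a set"
  assumes prime_p: "prime p"
    and v_nonneg: "v x \<ge> 0"
    and v_eq_0_iff: "v x = 0 \<longleftrightarrow> x = 0"
    and v_mult: "v (x * y) = v x * v y"
    and v_add: "v (x + y) \<le> max (v x) (v y)"
    and v_of_rat: "v (of_rat r) = padic_abs p r"
    and Qp_subfield: "subfield Qp class_ring"
    and Qp_dense: "x \<in> Qp \<Longrightarrow> e > 0 \<Longrightarrow> \<exists>r. v (x - of_rat r) < e"
    and Qp_complete:
      "(\<forall>i::nat. f i \<in> Qp) \<Longrightarrow> (\<forall>e>0. \<exists>N. \<forall>i\<ge>N. \<forall>j\<ge>N. v (f i - f j) < e)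
        \<Longrightarrow> \<exists>l\<in>Qp. (\<lambda>i. v (f i - l)) \<longlonglongrightarrow> 0"
    and F_subfield: "subfield F class_ring"
    and Qp_subset_F: "Qp \<subseteq> F"
    and F_finite: "ring.finite_dimension class_ring Qp F"
    and closure: "algebraic_closure class_ring F"

definition residue_card :: "('a::field_char_0 \<Rightarrow> real) \<Rightarrow> 'a set \<Rightarrow> nat" where
  "residue_card v F =
     card ({x \<in> F. v x \<le> 1} // {(x, y). x \<in> F \<and> y \<in> F \<and> v x \<le> 1 \<and> v y \<le> 1 \<and> v (x - y) < 1})"

section \<open>The Weil group\<close>

definition galois :: "'a::field_char_0 set \<Rightarrow> ('a \<Rightarrow> 'a) set" where
  "galois F = {g. bij g \<and> (\<forall>x y. g (x + y) = g x + g y) \<and> (\<forall>x y. g (x * y) = g x * g y)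
                \<and> (\<forall>x\<in>F. g x = x)}"

text \<open>\<open>g\<close> induces \<open>x \<mapsto> x ^ m\<close> on the residue field of the algebraic closure.\<close>

definition residually_power :: "('a::field_char_0 \<Rightarrow> real) \<Rightarrow> nat \<Rightarrow> ('a \<Rightarrow> 'a) \<Rightarrow> bool" where
  "residually_power v m g \<longleftrightarrow> (\<forall>x. v x \<le> 1 \<longrightarrow> v (g x - x ^ m) < 1)"

definition weil :: "('a::field_char_0 \<Rightarrow> real) \<Rightarrow> 'a set \<Rightarrow> ('a \<Rightarrow> 'a) set" where
  "weil v F = {g \<in> galois F. \<exists>k. residually_power v (residue_card v F ^ k) g
                              \<or> residually_power v (residue_card v F ^ k) (inv_into UNIV g)}"

definition geometric_frobenius ::
    "('a::field_char_0 \<Rightarrow> real) \<Rightarrow> 'a set \<Rightarrow> ('a \<Rightarrow> 'a) \<Rightarrow> bool" where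
  "geometric_frobenius v F g \<longleftrightarrow>
     g \<in> weil v F \<and> residually_power v (residue_card v F) (inv_into UNIV g)"

definition inertia :: "('a::field_char_0 \<Rightarrow> real) \<Rightarrow> 'a set \<Rightarrow> ('a \<Rightarrow> 'a) set" where
  "inertia v F = {g \<in> galois F. \<forall>x. v x \<le> 1 \<longrightarrow> v (g x - x) < 1}"

text \<open>
  Wild inertia as the ramification group of the valuation: \<open>g x / x\<close> is congruent to \<open>1\<close>
  modulo the maximal ideal for every nonzero \<open>x\<close>, i.e. \<open>g\<close> is killed by all tame characters.
  On a finite Galois extension with uniformiser \<open>u\<close> this amounts to the usual condition on
  \<open>g u / u\<close> defining the first ramification group.
\<close>

definition wild_inertia :: "('a::field_char_0 \<Rightarrow> real) \<Rightarrow> 'a set \<Rightarrow> ('a \<Rightarrow> 'a) set" where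
  "wild_inertia v F = {g \<in> inertia v F. \<forall>x. x \<noteq> 0 \<longrightarrow> v (g x / x - 1) < 1}"

definition automorphism_group :: "('a \<Rightarrow> 'a) set \<Rightarrow> ('a \<Rightarrow> 'a) monoid" where
  "automorphism_group G = \<lparr>carrier = G, monoid.mult = (\<circ>), one = id\<rparr>"

text \<open>
  Inertia is open and carries the Krull topology.  Finite sets \<open>S\<close> stand for the finite
  extensions of \<open>F\<close> that they generate.
\<close>

definition weil_topology :: "('a::field_char_0 \<Rightarrow> real) \<Rightarrow> 'a set \<Rightarrow> ('a \<Rightarrow> 'a) topology" where
  "weil_topology v F = topology_generated_by
     {(\<lambda>h. g \<circ> h) ` {h \<in> inertia v F. \<forall>x\<in>S. h x = x} | g S. g \<in> weil v F \<and> finite S}"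

abbreviation tame_quotient ::
    "('a::field_char_0 \<Rightarrow> real) \<Rightarrow> 'a set \<Rightarrow> ('a \<Rightarrow> 'a) set monoid" where
  "tame_quotient v F \<equiv> automorphism_group (inertia v F) Mod wild_inertia v F"

definition tame_topology ::
    "('a::field_char_0 \<Rightarrow> real) \<Rightarrow> 'a set \<Rightarrow> ('a \<Rightarrow> 'a) set topology" where
  "tame_topology v F = topology (\<lambda>U. U \<subseteq> carrier (tame_quotient v F) \<and>
     openin (subtopology (weil_topology v F) (inertia v F)) (\<Union>U))"

definition topological_generator ::
    "('g, 'm) monoid_scheme \<Rightarrow> 'g topology \<Rightarrow> 'g \<Rightarrow> bool" where
  "topological_generator G T g \<longleftrightarrow>
     g \<in> carrier G \<and> T closure_of (generate G {g}) = carrier G"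

section \<open>Representations\<close>

abbreviation GL :: "'k::field itself \<Rightarrow> nat \<Rightarrow> 'k mat monoid" where
  "GL ty n \<equiv> units_of (ring_mat ty n ())"

definition smooth_rep :: "('a::field_char_0 \<Rightarrow> real) \<Rightarrow> 'a set \<Rightarrow> nat
    \<Rightarrow> (('a \<Rightarrow> 'a) \<Rightarrow> 'k::field mat) \<Rightarrow> bool" where
  "smooth_rep v F n \<rho> \<longleftrightarrow>
     \<rho> \<in> hom (automorphism_group (weil v F)) (GL TYPE('k) n) \<and>
     continuous_map (weil_topology v F) (discrete_topology (carrier (GL TYPE('k) n))) \<rho>"

definition subrep :: "'g set \<Rightarrow> nat \<Rightarrow> ('g \<Rightarrow> 'k::field mat) \<Rightarrow> 'k vec set \<Rightarrow> bool" where
  "subrep W n \<rho> U \<longleftrightarrow> VectorSpace.subspace class_ring U (module_vec TYPE('k) n) \<and>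
     (\<forall>g\<in>W. \<forall>u\<in>U. \<rho> g *\<^sub>v u \<in> U)"

definition irreducible_subrep ::
    "'g set \<Rightarrow> nat \<Rightarrow> ('g \<Rightarrow> 'k::field mat) \<Rightarrow> 'k vec set \<Rightarrow> bool" where
  "irreducible_subrep W n \<rho> U \<longleftrightarrow> subrep W n \<rho> U \<and> U \<noteq> {0\<^sub>v n} \<and>
     (\<forall>U'. subrep W n \<rho> U' \<and> U' \<subseteq> U \<longrightarrow> U' = {0\<^sub>v n} \<or> U' = U)"

definition semisimple_rep :: "'g set \<Rightarrow> nat \<Rightarrow> ('g \<Rightarrow> 'k::field mat) \<Rightarrow> bool" where
  "semisimple_rep W n \<rho> \<longleftrightarrow>
     (\<exists>(k::nat) U. (\<forall>i<k. irreducible_subrep W n \<rho> (U i)) \<and>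
        (\<forall>x\<in>carrier_vec n. \<exists>!w. w \<in> (\<Pi>\<^sub>E i\<in>{..<k}. U i) \<and>
           x = (\<Oplus>\<^bsub>module_vec TYPE('k) n\<^esub>i\<in>{..<k}. w i)))"

definition invariants :: "'g set \<Rightarrow> nat \<Rightarrow> ('g \<Rightarrow> 'k::field mat) \<Rightarrow> 'k vec set" where
  "invariants H n \<rho> = {u \<in> carrier_vec n. \<forall>h\<in>H. \<rho> h *\<^sub>v u = u}"

abbreviation subspace_of_vec :: "nat \<Rightarrow> 'k::field vec set \<Rightarrow> ('k, 'k vec) module" where
  "subspace_of_vec n U \<equiv> (module_vec TYPE('k) n)\<lparr>carrier := U\<rparr>"

definition subspace_dim :: "nat \<Rightarrow> 'k::field vec set \<Rightarrow> nat" where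
  "subspace_dim n U = vectorspace.dim class_ring (subspace_of_vec n U)"

section \<open>Characteristic polynomials and L-factors\<close>

definition Char :: "'k::field mat \<Rightarrow> 'k poly" where
  "Char A = det (1\<^sub>m (dim_row A) - [:0, 1:] \<cdot>\<^sub>m map_mat (\<lambda>a. [:a:]) A)"

text \<open>
  \<open>det(1 - XA | U)\<close> for an \<open>A\<close>-stable subspace \<open>U\<close>: the columns of \<open>B\<close> form a basis of \<open>U\<close> and
  \<open>M\<close> is the matrix of \<open>A\<close> on \<open>U\<close> in this basis.  The value does not depend on the basis.
\<close>

definition Char_on :: "nat \<Rightarrow> 'k::field mat \<Rightarrow> 'k vec set \<Rightarrow> 'k poly" where
  "Char_on n A U = (SOME P. \<exists>bs M B. distinct bs \<and>
     vectorspace.basis class_ring (subspace_of_vec n U) (set bs) \<and>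
     B = mat_of_cols n bs \<and> M \<in> carrier_mat (length bs) (length bs) \<and>
     A * B = B * M \<and> P = Char M)"

text \<open>Evaluation of a polynomial at an element \<open>Y\<close> of \<open>\<kappa>(X)\<close>.\<close>

definition eval_ratfun :: "'k::field poly \<Rightarrow> 'k poly fract \<Rightarrow> 'k poly fract" where
  "eval_ratfun P Y = poly (map_poly (\<lambda>c. Fract [:c:] 1) P) Y"

definition ratfun_X :: "'k::field poly fract" where
  "ratfun_X = Fract [:0, 1:] 1"

text \<open>
  \<open>L(\<rho>, Y)\<close>, computed with the geometric Frobenius \<open>\<phi>\<close>; the choice of \<open>\<phi>\<close> is immaterial since
  two choices differ by inertia.
\<close>

definition L_factor :: "('a::field_char_0 \<Rightarrow> real) \<Rightarrow> 'a set \<Rightarrow> ('a \<Rightarrow> 'a) \<Rightarrow> nat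
    \<Rightarrow> (('a \<Rightarrow> 'a) \<Rightarrow> 'k::field mat) \<Rightarrow> 'k poly fract \<Rightarrow> 'k poly fract" where
  "L_factor v F \<phi> n \<rho> Y =
     inverse (eval_ratfun (Char_on n (\<rho> \<phi>) (invariants (inertia v F) n \<rho>)) Y)"

definition geometric_sum :: "nat \<Rightarrow> nat \<Rightarrow> 'k::field mat \<Rightarrow> 'k mat" where
  "geometric_sum n m A = (\<Oplus>\<^bsub>ring_mat TYPE('k) n ()\<^esub>i\<in>{..<m}. A ^\<^sub>m i)"

end

theory Submission
  imports Defs
    "Jordan_Normal_Form.Char_Poly"
    "Jordan_Normal_Form.DL_Rank"
    "Jordan_Normal_Form.Matrix_Kernel"
begin

text \<open>
  Geometric Frobenius acts on tame characters through the residue field, which gives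
  \<open>\<sigma> Fr = Fr \<sigma>\<^sup>q\<close>; the image of inertia is determined by \<open>\<sigma>\<close>, so \<open>\<rho>\<^sup>I\<close> is the kernel of \<open>\<sigma> - 1\<close>,
  and by semisimplicity \<open>\<sigma> - 1\<close> is invertible on the quotient by \<open>\<rho>\<^sup>I\<close>.  In a basis extending one
  of \<open>\<rho>\<^sup>I\<close> all matrices are block upper triangular.  On \<open>\<rho>\<^sup>I\<close> the sum \<open>N = 1 + \<dots> + \<sigma>\<^sup>q\<^sup>-\<^sup>1\<close> is
  multiplication by \<open>q\<close>, which turns \<open>X\<close> into \<open>q X\<close>.  On the quotient, \<open>Fr N (\<sigma> - 1) = (\<sigma> - 1) Fr\<close>
  shows that \<open>N\<close> has determinant \<open>1\<close> and that \<open>N Fr\<close> is conjugate to \<open>Fr\<close>.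
\<close>

section \<open>Inertia and tame ramification\<close>

text \<open>Invariance of \<open>v\<close> under automorphisms is not among the locale assumptions.
  It is derived for automorphisms that map the valuation ring into itself, which the residual
  conditions in \<open>inertia\<close> and \<open>weil\<close> guarantee. Tame characters are
  treated without uniformisers, through x |-> s x / x for all nonzero x of the algebraic closure:
  modulo the maximal ideal this is multiplicative in x and in s, and elements of inertia with the
  same residual values differ by wild inertia. So the commutation relation holds in the Weil group
  only up to a wild factor, which \<rho> kills. The obstacle in the representation theory is that
  \<sigma> - 1 need not commute with \<rho>, so it is not an intertwiner. What remains is that it
  preserves every subrepresentation, and that its kernel, being the invariants of a normal subgroup,
  is itself one. This suffices to show that \<sigma> - 1 and its square have the same kernel, which
  is invertibility on the quotient. No stable complement of the invariants is chosen: the upper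
  right blocks stay arbitrary, because determinants and \<open>Char\<close> see only the diagonal
  blocks.\<close>

lemma galoisD:
  assumes "g \<in> galois F"
  shows "bij g" "g (x + y) = g x + g y" "g (x * y) = g x * g y"
  using assms by (auto simp: galois_def)

lemma galois_simps:
  fixes g :: "'a::field_char_0 \<Rightarrow> 'a"
  assumes g: "g \<in> galois F"
  shows "g 0 = 0" "g 1 = 1" "g x = 0 \<longleftrightarrow> x = 0" "g (- x) = - g x" "g (x - y) = g x - g y"
    "g (inverse x) = inverse (g x)" "g (x / y) = g x / g y" "g (x ^ k) = g x ^ k"
    "g (x powi j) = g x powi j" "g (of_nat m) = of_nat m"
    "g (inv_into UNIV g x) = x" "inv_into UNIV g (g x) = x"
proof -
  note [simp] = galoisD(2,3)[OF g]
  have bij: "bij g" using galoisD[OF g] by blast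
  then have inj: "g a = g b \<longleftrightarrow> a = b" for a b
    by (metis bij_def injD)
  have "g 0 + g 0 = g 0 + 0"
    by (metis add.right_neutral galoisD(2)[OF g])
  then show g0[simp]: "g 0 = 0" by simp
  show g_eq_0[simp]: "g x = 0 \<longleftrightarrow> x = 0" for x using inj[of x 0] by simp
  have "g 1 * g 1 = g 1 * 1"
    by (metis mult.right_neutral galoisD(3)[OF g])
  then show g1[simp]: "g 1 = 1" using g_eq_0[of 1] by simp
  show neg[simp]: "g (- x) = - g x" for x
    using galoisD(2)[OF g, of x "- x"] by (simp add: add_eq_0_iff)
  show "g (x - y) = g x - g y" using galoisD(2)[OF g, of x "- y"] by simp
  show inv[simp]: "g (inverse x) = inverse (g x)" for x
  proof (cases "x = 0")
    case False
    then have "g x * g (inverse x) = 1" using galoisD(3)[OF g, of x "inverse x"] by simp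
    then show ?thesis by (simp add: inverse_unique)
  qed simp
  show "g (x / y) = g x / g y" by (simp add: divide_inverse)
  show pow[simp]: "g (x ^ k) = g x ^ k" for x k by (induction k) simp_all
  show "g (x powi j) = g x powi j" by (simp add: power_int_def)
  show "g (of_nat m) = of_nat m" by (induction m) simp_all
  show "g (inv_into UNIV g x) = x" using bij by (simp add: bij_is_surj surj_f_inv_f)
  show "inv_into UNIV g (g x) = x" using bij by (simp add: bij_is_inj)
qed

lemma galois_id: "id \<in> galois F"
  by (simp add: galois_def)

lemma galois_comp: "g \<in> galois F \<Longrightarrow> h \<in> galois F \<Longrightarrow> g \<circ> h \<in> galois F"
  by (simp add: galois_def bij_comp)

lemma galois_inv:
  assumes g: "g \<in> galois F"
  shows "inv_into UNIV g \<in> galois F"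
proof -
  let ?h = "inv_into UNIV g"
  have bij: "bij g" using galoisD[OF g] by blast
  then have inj: "g a = g b \<Longrightarrow> a = b" for a b by (metis bij_def injD)
  have "?h (x + y) = ?h x + ?h y" for x y
    by (rule inj) (simp add: galois_simps[OF g] galoisD[OF g])
  moreover have "?h (x * y) = ?h x * ?h y" for x y
    by (rule inj) (simp add: galois_simps[OF g] galoisD[OF g])
  moreover have "?h x = x" if "x \<in> F" for x
    using galois_simps(12)[OF g, of x] that g by (simp add: galois_def)
  ultimately show ?thesis using bij_imp_bij_inv[OF bij] by (simp add: galois_def)
qed

context padic_field_in_closure
begin

section \<open>The valuation and its invariance under the Weil group\<close>

lemma v_simps [simp]: "v 0 = 0" "v 1 = 1" "v (- x) = v x" "v (x ^ k) = v x ^ k"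
    "v (inverse x) = inverse (v x)" "v (x / y) = v x / v y" "v (x powi j) = v x powi j"
proof -
  show v0: "v 0 = 0" by (simp add: v_eq_0_iff)
  have "v 1 * v 1 = v 1 * 1" using v_mult[of 1 1] by simp
  then show v1: "v 1 = 1" using v_eq_0_iff[of 1] by simp
  have "v (-1) * v (-1) = 1" using v_mult[of "-1" "-1"] v1 by simp
  then have "v (-1) = 1" using v_nonneg[of "-1"] by (simp add: square_eq_1_iff)
  then show "v (- x) = v x" using v_mult[of "-1" x] by simp
  show pow: "v (x ^ k) = v x ^ k" for x k using v1 by (induction k) (simp_all add: v_mult)
  show inv: "v (inverse x) = inverse (v x)" for x
  proof (cases "x = 0")
    case False
    then have "v x * v (inverse x) = 1" using v_mult[of x "inverse x"] v1 by simp
    then show ?thesis by (simp add: inverse_unique)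
  qed (simp add: v0)
  show "v (x / y) = v x / v y" by (simp add: divide_inverse v_mult inv)
  show "v (x powi j) = v x powi j" by (simp add: power_int_def pow inv)
qed

lemma v_pos: "x \<noteq> 0 \<Longrightarrow> v x > 0"
  using v_nonneg[of x] v_eq_0_iff[of x] by linarith

lemma v_diff_commute: "v (x - y) = v (y - x)"
  using v_simps(3)[of "x - y"] by simp

lemma v_diff_trans: "v (x - y) < c \<Longrightarrow> v (y - z) < c \<Longrightarrow> v (x - z) < c"
  using v_add[of "x - y" "y - z"] by simp

lemma v_p: "v (of_nat p) = inverse (real p)"
proof -
  have p: "p \<noteq> 0" "\<not> is_unit (int p)" using prime_p by (auto simp: prime_nat_iff)
  have "v (of_rat (of_nat p)) = padic_abs p (of_nat p)" by (rule v_of_rat)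
  moreover have "quotient_of (of_nat p) = (int p, 1)"
    using quotient_of_int[of "int p"] by simp
  ultimately show ?thesis
    using p by (simp add: padic_abs_def multiplicity_self multiplicity_one power_int_minus)
qed

text \<open>An automorphism stretching \<open>x\<close> stretches \<open>x\<^sup>N\<close> by more than \<open>p\<close>; scaled by a power of
  \<open>p\<close>, \<open>x\<^sup>N\<close> then moves out of the valuation ring.\<close>

lemma v_galois_le:
  assumes g: "g \<in> galois F" and int: "\<And>x. v x \<le> 1 \<Longrightarrow> v (g x) \<le> 1"
  shows "v (g x) \<le> v x"
proof (rule ccontr)
  assume "\<not> v (g x) \<le> v x"
  then have less: "v x < v (g x)" by simp
  have "x \<noteq> 0" using less galois_simps(1)[OF g] by auto
  then have pos: "v x > 0" by (rule v_pos)
  have p1: "real p > 1" using prime_p prime_gt_1_nat by simp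
  define c where "c = v (g x) / v x"
  have "c > 1" using less pos by (simp add: c_def)
  then obtain N where N: "real p < c ^ N" using real_arch_pow by blast
  define k where "k = \<lfloor>log p (v x ^ N)\<rfloor>"
  have "real p powr k \<le> v x ^ N \<and> v x ^ N < real p powr (k + 1)"
    using floor_log_eq_powr_iff[of "v x ^ N" "real p" k] pos p1 by (simp add: k_def)
  then have k: "real p powi k \<le> v x ^ N" "v x ^ N < real p powi (k + 1)"
    using p1 powr_real_of_int'[of "real p" k] powr_real_of_int'[of "real p" "k + 1"] by auto
  \<comment> \<open>Since \<open>v p = 1/p\<close>, the value of \<open>z\<close> lies between
    \<open>1/p\<close> and 1: \<open>z\<close> is integral, but stretching it by
    \<open>c ^ N > p\<close> makes \<open>g z\<close> non-integral.\<close>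
  define z where "z = x ^ N * of_nat p powi (k + 1)"
  have vz: "v z = v x ^ N / real p powi (k + 1)"
    by (simp add: z_def v_mult v_p power_int_inverse divide_inverse)
  have ppos: "real p powi (k + 1) > 0" "real p powi k > 0" using p1 by auto
  have "v z \<le> 1" using k(2) ppos by (simp add: vz)
  then have "v (g z) \<le> 1" by (rule int)
  moreover have "v (g z) = c ^ N * v x ^ N / real p powi (k + 1)"
    using pos by (simp add: z_def galoisD[OF g] galois_simps[OF g] v_mult v_p power_int_inverse
        divide_inverse[of _ "_ powi _"] c_def power_divide)
  moreover have "real p * real p powi k < c ^ N * v x ^ N"
    by (rule mult_less_le_imp_less) (use N k(1) ppos p1 pos in auto)
  moreover have "real p * real p powi k = real p powi (k + 1)"
    using p1 by (simp add: power_int_add)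
  ultimately show False using ppos by (simp add: divide_le_eq)
qed

text \<open>Applying the inequality to \<open>inverse x\<close> reverses it, so integrality of the
  inverse automorphism does not have to be established first.\<close>

lemma v_galois_eq:
  assumes g: "g \<in> galois F" and int: "\<And>x. v x \<le> 1 \<Longrightarrow> v (g x) \<le> 1"
  shows "v (g x) = v x"
proof (cases "x = 0")
  case False
  have "v x > 0" "v (g x) > 0" using False galois_simps(3)[OF g, of x] by (auto intro: v_pos)
  moreover have "inverse (v (g x)) \<le> inverse (v x)"
    using v_galois_le[OF assms, of "inverse x"] by (simp add: galois_simps[OF g])
  ultimately show ?thesis using v_galois_le[OF assms, of x] by (simp add: antisym)
qed (simp add: galois_simps[OF g])

text \<open>Powers of integral elements are integral, and an error of value below 1 does not leave
  the valuation ring; hence a residual power map preserves integrality and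
  \<open>v_galois_eq\<close> applies.\<close>

lemma residually_power_v:
  assumes g: "g \<in> galois F" and m: "residually_power v m g"
  shows "v (g x) = v x"
proof (rule v_galois_eq[OF g])
  fix x assume x: "v x \<le> 1"
  then have "v (g x - x ^ m) < 1" "v (x ^ m) \<le> 1"
    using m by (auto simp: residually_power_def v_nonneg power_le_one)
  then show "v (g x) \<le> 1" using v_add[of "g x - x ^ m" "x ^ m"] by simp
qed

lemma weil_v:
  assumes g: "g \<in> weil v F"
  shows "v (g x) = v x"
proof -
  have gal: "g \<in> galois F" using g by (simp add: weil_def)
  from g consider m where "residually_power v m g"
    | m where "residually_power v m (inv_into UNIV g)"
    by (auto simp: weil_def)
  then show ?thesis
  proof cases
    case 1
    then show ?thesis using residually_power_v[OF gal] by blast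
  next
    case 2
    then show ?thesis
      using residually_power_v[OF galois_inv[OF gal] 2, of "g x"] by (simp add: galois_simps[OF gal])
  qed
qed

section \<open>Inertia and wild inertia as normal subgroups\<close>

lemma inertia_subset_weil: "inertia v F \<subseteq> weil v F"
proof
  fix g assume "g \<in> inertia v F"
  \<comment> \<open>Exponent 0 turns the residual power map into x |-> x, the trivial action on the
    residue field.\<close>
  then have "g \<in> galois F" "residually_power v (residue_card v F ^ 0) g"
    by (simp_all add: inertia_def residually_power_def)
  then show "g \<in> weil v F" unfolding weil_def by blast
qed

lemma inertia_galois: "g \<in> inertia v F \<Longrightarrow> g \<in> galois F"
  by (simp add: inertia_def)

lemma weil_galois: "g \<in> weil v F \<Longrightarrow> g \<in> galois F"
  by (simp add: weil_def)

lemma inertia_v: "g \<in> inertia v F \<Longrightarrow> v (g x) = v x"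
  using weil_v inertia_subset_weil by blast

lemma inertia_id: "id \<in> inertia v F"
  by (simp add: inertia_def galois_id)

lemma inertia_comp:
  assumes "g \<in> inertia v F" "h \<in> inertia v F"
  shows "g \<circ> h \<in> inertia v F"
proof -
  have "v (g (h x) - x) < 1" if "v x \<le> 1" for x
    using v_diff_trans[of "g (h x)" "h x" 1 x] assms that inertia_v[of h x]
    by (simp add: inertia_def)
  then show ?thesis using assms by (simp add: inertia_def galois_comp)
qed

text \<open>Normality of inertia, in the form that later moves \<open>\<rho> h\<close> past
  \<open>\<rho> g\<close>. Since \<open>g\<close> preserves \<open>v\<close>, the displacement of
  \<open>x\<close> under the conjugate has the same size as that of \<open>g x\<close> under
  \<open>h\<close>.\<close>

lemma inertia_conj:
  assumes g: "g \<in> weil v F" and h: "h \<in> inertia v F"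
  shows "inv_into UNIV g \<circ> h \<circ> g \<in> inertia v F"
proof -
  have gal: "g \<in> galois F" using g by (rule weil_galois)
  have "v (inv_into UNIV g (h (g x)) - x) < 1" if "v x \<le> 1" for x
  proof -
    have "v (inv_into UNIV g (h (g x)) - x) = v (h (g x) - g x)"
      using weil_v[OF g, of "inv_into UNIV g (h (g x)) - x"] by (simp add: galois_simps[OF gal])
    then show ?thesis using h that weil_v[OF g] by (simp add: inertia_def)
  qed
  then show ?thesis
    using galois_comp[OF galois_comp[OF galois_inv[OF gal] inertia_galois[OF h]] gal]
    by (simp add: inertia_def)
qed

lemma inertia_inv:
  assumes g: "g \<in> inertia v F"
  shows "inv_into UNIV g \<in> inertia v F"
proof -
  note gal = inertia_galois[OF g]
  have "v (inv_into UNIV g x - x) = v (g x - x)" for x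
    using inertia_v[OF g, of "inv_into UNIV g x - x"]
    by (simp add: galois_simps[OF gal] v_diff_commute)
  then show ?thesis using g galois_inv[OF gal] by (simp add: inertia_def)
qed

text \<open>With the denominator cleared, the condition has the shape that ultrametric estimates
  such as \<open>v_diff_trans\<close> can chain.\<close>

lemma wild_inertia_iff:
  "g \<in> wild_inertia v F \<longleftrightarrow> g \<in> inertia v F \<and> (\<forall>x. x \<noteq> 0 \<longrightarrow> v (g x - x) < v x)"
proof -
  have "v (g x / x - 1) < 1 \<longleftrightarrow> v (g x - x) < v x" if "x \<noteq> 0" for x
  proof -
    have "g x / x - 1 = (g x - x) / x" using that by (simp add: diff_divide_distrib)
    then show ?thesis using v_pos[OF that] by simp
  qed
  then show ?thesis by (auto simp: wild_inertia_def)
qed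

lemma group_inertia: "group (automorphism_group (inertia v F))"
proof (rule groupI)
  fix g assume "g \<in> carrier (automorphism_group (inertia v F))"
  then have g: "g \<in> inertia v F" by (simp add: automorphism_group_def)
  have "inv_into UNIV g \<circ> g = id" using galois_simps(12)[OF inertia_galois[OF g]] by auto
  then show "\<exists>h\<in>carrier (automorphism_group (inertia v F)).
      h \<otimes>\<^bsub>automorphism_group (inertia v F)\<^esub> g = \<one>\<^bsub>automorphism_group (inertia v F)\<^esub>"
    using inertia_inv[OF g] by (auto simp: automorphism_group_def)
qed (auto simp: automorphism_group_def inertia_id o_assoc intro: inertia_comp)

lemma inv_automorphism_group_inertia:
  assumes g: "g \<in> inertia v F"
  shows "inv\<^bsub>automorphism_group (inertia v F)\<^esub> g = inv_into UNIV g"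
proof (rule group.inv_equality[OF group_inertia])
  show "inv_into UNIV g \<otimes>\<^bsub>automorphism_group (inertia v F)\<^esub> g
      = \<one>\<^bsub>automorphism_group (inertia v F)\<^esub>"
    using galois_simps(12)[OF inertia_galois[OF g]] by (auto simp: automorphism_group_def)
qed (use g inertia_inv in \<open>auto simp: automorphism_group_def\<close>)

lemma wild_inertia_normal: "wild_inertia v F \<lhd> automorphism_group (inertia v F)"
proof -
  interpret group "automorphism_group (inertia v F)" by (rule group_inertia)
  have sub: "subgroup (wild_inertia v F) (automorphism_group (inertia v F))"
  proof (rule subgroupI)
    show "wild_inertia v F \<subseteq> carrier (automorphism_group (inertia v F))"
      by (auto simp: automorphism_group_def wild_inertia_def)
    have "id \<in> wild_inertia v F" by (simp add: wild_inertia_iff inertia_id v_pos)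
    then show "wild_inertia v F \<noteq> {}" by blast
  next
    fix g assume g: "g \<in> wild_inertia v F"
    then have gI: "g \<in> inertia v F" by (simp add: wild_inertia_def)
    have "v (inv_into UNIV g x - x) = v (g x - x)" for x
      using inertia_v[OF gI, of "inv_into UNIV g x - x"]
      by (simp add: galois_simps[OF inertia_galois[OF gI]] v_diff_commute)
    then have "inv_into UNIV g \<in> wild_inertia v F"
      using g inertia_inv[OF gI] by (simp add: wild_inertia_iff)
    then show "inv\<^bsub>automorphism_group (inertia v F)\<^esub> g \<in> wild_inertia v F"
      by (simp add: inv_automorphism_group_inertia[OF gI])
  next
    fix g h assume gh: "g \<in> wild_inertia v F" "h \<in> wild_inertia v F"
    have "v (g (h x) - x) < v x" if "x \<noteq> 0" for x
    proof (rule v_diff_trans)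
      have "h x \<noteq> 0" "v (h x) = v x"
        using gh that galois_simps(3)[OF inertia_galois, of h x] inertia_v[of h x]
        by (auto simp: wild_inertia_def)
      then show "v (g (h x) - h x) < v x" using gh by (metis wild_inertia_iff)
    qed (use gh that in \<open>auto simp: wild_inertia_iff\<close>)
    then show "g \<otimes>\<^bsub>automorphism_group (inertia v F)\<^esub> h \<in> wild_inertia v F"
      using gh inertia_comp by (auto simp: wild_inertia_iff automorphism_group_def)
  qed
  have "h \<circ> g \<circ> inv_into UNIV h \<in> wild_inertia v F"
    if h: "h \<in> inertia v F" and g: "g \<in> wild_inertia v F" for g h
  proof -
    have hi: "inv_into UNIV h \<in> inertia v F" using h by (rule inertia_inv)
    note hg = inertia_galois[OF h]
    have "v (h (g (inv_into UNIV h x)) - x) < v x" if "x \<noteq> 0" for x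
    proof -
      \<comment> \<open>Writing \<open>x = h y\<close> turns the displacement of \<open>x\<close>
        under the conjugate into the image under \<open>h\<close> of the displacement of
        \<open>y\<close> under \<open>g\<close>, and \<open>h\<close> preserves
        \<open>v\<close>.\<close>
      define y where "y = inv_into UNIV h x"
      have x: "x = h y" using galois_simps(11)[OF hg] by (simp add: y_def)
      have "y \<noteq> 0" using that galois_simps(1)[OF hg] by (auto simp: x)
      then have "v (g y - y) < v y" using g by (simp add: wild_inertia_iff)
      moreover have "v (h (g y) - x) = v (g y - y)"
        using inertia_v[OF h, of "g y - y"] by (simp add: x galois_simps[OF hg])
      ultimately show ?thesis using inertia_v[OF h, of y] by (simp add: x galois_simps[OF hg])
    qed
    then show ?thesis using g h hi by (simp add: wild_inertia_iff inertia_comp)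
  qed
  then show ?thesis
    using sub unfolding normal_inv_iff
    by (auto simp: automorphism_group_def
        inv_automorphism_group_inertia[unfolded automorphism_group_def])
qed

section \<open>The tame character and its conjugation by Frobenius\<close>

lemma v_power_diff:
  assumes "v x \<le> 1" "v y \<le> 1" "v (x - y) < 1"
  shows "v (x ^ k - y ^ k) < 1"
proof (induction k)
  case (Suc k)
  have small: "v (a * b) < 1" if "v a \<le> 1" "v b < 1" for a b
    using that v_nonneg[of a] v_nonneg[of b]
    by (simp add: v_mult mult_le_one le_less_trans[OF mult_left_le_one_le])
  have "v (x * x ^ k - x * y ^ k) < 1"
    using small[of x "x ^ k - y ^ k"] Suc assms by (simp add: right_diff_distrib)
  moreover have "v (x * y ^ k - y * y ^ k) < 1"
    using small[of "y ^ k" "x - y"] assms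
    by (simp add: left_diff_distrib mult.commute power_le_one v_nonneg)
  ultimately show ?case using v_diff_trans by (metis power_Suc)
qed simp

lemma inertia_funpow: "s \<in> inertia v F \<Longrightarrow> s ^^ k \<in> inertia v F"
  by (induction k) (auto intro: inertia_id inertia_comp)

text \<open>Residually, the tame character of \<open>s ^^ k\<close> is the k-th power of that of
  \<open>s\<close>. Each further application of \<open>s\<close> contributes one factor
  \<open>s x / x\<close>, because \<open>s\<close> fixes the unit \<open>(s x / x) ^ k\<close>
  modulo the maximal ideal.\<close>

lemma funpow_inertia_approx:
  assumes s: "s \<in> inertia v F" and x: "x \<noteq> 0"
  shows "v ((s ^^ k) x - (s x / x) ^ k * x) < v x"
proof (induction k)
  case (Suc k)
  note gal = inertia_galois[OF s]
  define u where "u = s x / x"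
  have vu: "v u = 1" and sx: "s x = u * x"
    using inertia_v[OF s, of x] v_pos[OF x] x by (auto simp: u_def)
  have "v (s ((s ^^ k) x) - s (u ^ k * x)) < v x"
    using Suc inertia_v[OF s, of "(s ^^ k) x - u ^ k * x"] by (simp add: galois_simps[OF gal] u_def)
  moreover have "v (s (u ^ k * x) - u ^ Suc k * x) < v x"
  proof -
    have "s (u ^ k * x) - u ^ Suc k * x = (s (u ^ k) - u ^ k) * (u * x)"
      using galoisD(3)[OF gal, of "u ^ k" x] by (simp add: sx algebra_simps)
    moreover have "v (s (u ^ k) - u ^ k) < 1" using s vu by (simp add: inertia_def)
    ultimately show ?thesis using v_pos[OF x] by (simp add: v_mult vu)
  qed
  ultimately have "v (s ((s ^^ k) x) - u ^ Suc k * x) < v x" by (rule v_diff_trans)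
  then show ?case by (simp add: u_def)
qed (use x in \<open>simp add: v_pos\<close>)

text \<open>Since the tame character \<open>x \<mapsto> s x / x\<close> is multiplicative and residually trivial on units,
  conjugation by a Frobenius affects it only through the action on the residue field.\<close>

lemma tame_relation:
  assumes s: "s \<in> inertia v F" and \<phi>: "\<phi> \<in> galois F"
    and res: "residually_power v m (inv_into UNIV \<phi>)"
  obtains w where "w \<in> wild_inertia v F" "s \<circ> \<phi> = \<phi> \<circ> (w \<circ> s ^^ m)"
proof -
  let ?f = "inv_into UNIV \<phi>"
  have f: "?f \<in> galois F" using \<phi> by (rule galois_inv)
  have vf: "v (?f x) = v x" for x using residually_power_v[OF f res] .
  have v\<phi>: "v (\<phi> x) = v x" for x using vf[of "\<phi> x"] by (simp add: galois_simps[OF \<phi>])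
  note sg = inertia_galois[OF s]
  note sm = inertia_funpow[OF s, of m]
  note smi = inertia_inv[OF sm]
  \<comment> \<open>The conjugate of \<open>s\<close> by Frobenius. The goal is that
    \<open>t\<close> and \<open>s ^^ m\<close> have the same tame character, so that they differ by
    wild inertia.\<close>
  define t where "t = ?f \<circ> s \<circ> \<phi>"
  have tI: "t \<in> inertia v F"
  proof -
    have "v (t x - x) < 1" if "v x \<le> 1" for x
    proof -
      have "v (t x - x) = v (s (\<phi> x) - \<phi> x)"
        using v\<phi>[of "t x - x"] by (simp add: t_def galois_simps[OF \<phi>])
      then show ?thesis using s that v\<phi> by (simp add: inertia_def)
    qed
    moreover have "t \<in> galois F" unfolding t_def using f sg \<phi> by (intro galois_comp)
    ultimately show ?thesis by (simp add: inertia_def)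
  qed
  have approx: "v (t x - (s ^^ m) x) < v x" if x: "x \<noteq> 0" for x
  proof -
    \<comment> \<open>\<open>u\<close> and \<open>u'\<close> are the values of the tame character of
      \<open>s\<close> at \<open>x\<close> and at \<open>\<phi> x\<close>. Their quotient is
      \<open>s a / a\<close>, and \<open>a\<close> is a unit because \<phi> preserves
      \<open>v\<close>; as \<open>s\<close> is residually trivial, \<open>u\<close> and
      \<open>u'\<close> agree modulo the maximal ideal.\<close>
    define y u u' a where defs: "y = \<phi> x" "u = s x / x" "u' = s y / y" "a = y / x"
    have y: "y \<noteq> 0" "v y = v x" using x v\<phi> galois_simps(3)[OF \<phi>, of x] by (auto simp: defs)
    have vx: "v x > 0" using x by (rule v_pos)
    have units: "v u = 1" "v u' = 1" "v a = 1"
      using inertia_v[OF s] y vx by (auto simp: defs)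
    have a0: "a \<noteq> 0" using x y by (simp add: defs)
    have "v (u' - u) < 1"
    proof -
      have "y = a * x" using x by (simp add: defs)
      then have "u' - u = (s a - a) * (u / a)"
        using x a0 unfolding defs(3) by (simp add: defs(2) galoisD(3)[OF sg] field_simps)
      moreover have "v (s a - a) < 1" using s units by (simp add: inertia_def)
      ultimately show ?thesis using units by (simp add: v_mult)
    qed
    then have "v (u' ^ m - u ^ m) < 1" using units by (intro v_power_diff) auto
    \<comment> \<open>This is where the Frobenius exponent enters: the inverse of \<phi> sends the
      residue of \<open>u'\<close> to its m-th power, which is also that of
      \<open>u\<close>.\<close>
    moreover have "v (?f u' - u' ^ m) < 1" using res units by (simp add: residually_power_def)
    ultimately have "v (?f u' - u ^ m) < 1" using v_diff_trans by blast
    moreover have "t x = ?f u' * x"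
    proof -
      have "s y = u' * y" using y by (simp add: defs)
      then show ?thesis by (simp add: t_def defs(1) galoisD(3)[OF f] galois_simps[OF \<phi>])
    qed
    ultimately have "v (t x - u ^ m * x) < v x"
      using vx by (simp add: v_mult flip: left_diff_distrib)
    moreover have "v (u ^ m * x - (s ^^ m) x) < v x"
      using funpow_inertia_approx[OF s x, of m] by (simp add: defs(2) v_diff_commute)
    ultimately show ?thesis using v_diff_trans by blast
  qed
  \<comment> \<open>The discrepancy between \<open>t\<close> and \<open>s ^^ m\<close>. Evaluated at
    \<open>z = (s ^^ m) x\<close>, the bound \<open>approx\<close> says exactly that it is
    wild.\<close>
  define w where "w = t \<circ> inv_into UNIV (s ^^ m)"
  note smg = inertia_galois[OF sm]
  have "v (w z - z) < v z" if "z \<noteq> 0" for z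
  proof -
    define x where "x = inv_into UNIV (s ^^ m) z"
    have z: "z = (s ^^ m) x" by (simp add: x_def galois_simps(11)[OF smg])
    have "x \<noteq> 0" using that galois_simps(1)[OF smg] by (auto simp: z)
    moreover have "w z = t x" by (simp add: w_def x_def)
    ultimately show ?thesis using approx[of x] inertia_v[OF sm, of x] by (simp add: z)
  qed
  moreover have "w \<in> inertia v F" unfolding w_def using tI smi by (rule inertia_comp)
  ultimately have "w \<in> wild_inertia v F" by (simp add: wild_inertia_iff)
  moreover have "s \<circ> \<phi> = \<phi> \<circ> (w \<circ> s ^^ m)"
    by (rule ext) (simp add: w_def t_def galois_simps[OF \<phi>] galois_simps(12)[OF smg])
  ultimately show ?thesis by (rule that)
qed

end

section \<open>Characteristic polynomials and block matrices\<close>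

lemma ring_hom_const_poly: "comm_ring_hom (\<lambda>a :: 'k::field. [:a:])"
  by unfold_locales (auto simp: one_pCons)

lemma Char_similar:
  fixes A :: "'k::field mat"
  assumes sim: "similar_mat A B"
  shows "Char A = Char B"
proof -
  interpret c: comm_ring_hom "\<lambda>a :: 'k. [:a:]" by (rule ring_hom_const_poly)
  obtain n P Q where PQ: "P * Q = 1\<^sub>m n" "Q * P = 1\<^sub>m n" "A = P * B * Q"
    and carr: "{A, B, P, Q} \<subseteq> carrier_mat n n"
    using similar_matD[OF sim] by blast
  let ?c = "map_mat (\<lambda>a. [:a:])"
  define Z :: "'k poly" where "Z = [:0, 1:]"
  have cc: "?c A \<in> carrier_mat n n" "?c B \<in> carrier_mat n n" "?c P \<in> carrier_mat n n"
    "?c Q \<in> carrier_mat n n"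
    using carr by auto
  have cPQ: "?c P * ?c Q = 1\<^sub>m n" "?c Q * ?c P = 1\<^sub>m n"
    using PQ carr c.mat_hom_mult[of P n n Q n] c.mat_hom_mult[of Q n n P n]
    by (auto simp: c.mat_hom_one)
  have cA: "?c A = ?c P * ?c B * ?c Q"
    using carr c.mat_hom_mult[of "P * B" n n Q n] c.mat_hom_mult[of P n n B n]
    by (auto simp: PQ(3))
  have "similar_mat (1\<^sub>m n - Z \<cdot>\<^sub>m ?c A) (1\<^sub>m n - Z \<cdot>\<^sub>m ?c B)"
  proof (rule similar_matI[OF _ cPQ])
    have "?c P * (1\<^sub>m n - Z \<cdot>\<^sub>m ?c B) * ?c Q = (?c P - Z \<cdot>\<^sub>m (?c P * ?c B)) * ?c Q"
      using cc by (simp add: mult_minus_distrib_mat[where nr = n and n = n and nc = n]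
          mult_smult_distrib[where nr = n and n = n and nc = n])
    also have "\<dots> = 1\<^sub>m n - Z \<cdot>\<^sub>m (?c P * ?c B * ?c Q)"
      using cc by (simp add: minus_mult_distrib_mat[where nr = n and n = n and nc = n]
          mult_smult_assoc_mat[where nr = n and n = n and nc = n] cPQ)
    finally show "1\<^sub>m n - Z \<cdot>\<^sub>m ?c A = ?c P * (1\<^sub>m n - Z \<cdot>\<^sub>m ?c B) * ?c Q"
      by (simp add: cA)
  qed (use cc in auto)
  then have "det (1\<^sub>m n - Z \<cdot>\<^sub>m ?c A) = det (1\<^sub>m n - Z \<cdot>\<^sub>m ?c B)" by (rule det_similar)
  moreover have "A \<in> carrier_mat n n" "B \<in> carrier_mat n n" using carr by auto
  ultimately show ?thesis by (simp add: Char_def Z_def)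
qed

lemma Char_four_block_upper:
  fixes A :: "'k::field mat"
  assumes A: "A \<in> carrier_mat d d" and B: "B \<in> carrier_mat d e" and D: "D \<in> carrier_mat e e"
  shows "Char (four_block_mat A B (0\<^sub>m e d) D) = Char A * Char D"
proof -
  let ?c = "map_mat (\<lambda>a. [:a:])"
  let ?X = "[:0, 1:] :: 'k poly"
  have "1\<^sub>m (d + e) - ?X \<cdot>\<^sub>m ?c (four_block_mat A B (0\<^sub>m e d) D)
      = four_block_mat (1\<^sub>m d - ?X \<cdot>\<^sub>m ?c A) (- (?X \<cdot>\<^sub>m ?c B)) (0\<^sub>m e d) (1\<^sub>m e - ?X \<cdot>\<^sub>m ?c D)"
    by (rule eq_matI) (use A B D in auto)
  moreover have "det \<dots> = det (1\<^sub>m d - ?X \<cdot>\<^sub>m ?c A) * det (1\<^sub>m e - ?X \<cdot>\<^sub>m ?c D)"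
    by (rule det_four_block_mat_lower_left_zero) (use A B D in auto)
  ultimately show ?thesis using A D by (simp add: Char_def)
qed

text \<open>Guarantees that \<open>Char\<close> is a nonzero polynomial, so the factor coming from
  the quotient by the invariants can be cancelled.\<close>

lemma poly_Char_0:
  fixes A :: "'k::field mat"
  assumes A: "A \<in> carrier_mat n n"
  shows "poly (Char A) 0 = 1"
proof -
  have p0: "comm_ring_hom (\<lambda>P :: 'k poly. poly P 0)" by unfold_locales auto
  have "poly (Char A) 0 = det (map_mat (\<lambda>P. poly P 0)
      (1\<^sub>m n - [:0, 1:] \<cdot>\<^sub>m map_mat (\<lambda>a. [:a:]) A))"
    using A by (simp add: Char_def comm_ring_hom.hom_det[OF p0])
  also have "map_mat (\<lambda>P. poly P 0) (1\<^sub>m n - [:0, 1:] \<cdot>\<^sub>m map_mat (\<lambda>a. [:a:]) A) = 1\<^sub>m n"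
    by (rule eq_matI) (use A in auto)
  finally show ?thesis by simp
qed

section \<open>Evaluation of polynomials in the field of rational functions\<close>

lemma comm_ring_hom_const_ratfun: "comm_ring_hom (\<lambda>c :: 'k::field. Fract [:c:] 1)"
  by unfold_locales (auto simp: one_pCons Zero_fract_def One_fract_def mult.commute)

lemma comm_ring_hom_eval_ratfun: "comm_ring_hom (\<lambda>P :: 'k::field poly. eval_ratfun P Y)"
proof -
  interpret c: comm_ring_hom "\<lambda>c :: 'k. Fract [:c:] 1" by (rule comm_ring_hom_const_ratfun)
  interpret m: map_poly_comm_ring_hom "\<lambda>c :: 'k. Fract [:c:] 1" ..
  show ?thesis
    unfolding eval_ratfun_def by unfold_locales (auto simp: hom_distribs)
qed

lemma eval_ratfun_pCons:
  fixes P :: "'k::field poly"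
  shows "eval_ratfun (pCons c P) Y = Fract [:c:] 1 + Y * eval_ratfun P Y"
proof -
  interpret c: comm_ring_hom "\<lambda>c :: 'k. Fract [:c:] 1" by (rule comm_ring_hom_const_ratfun)
  show ?thesis by (simp add: eval_ratfun_def c.map_poly_pCons_hom)
qed

text \<open>At the indeterminate, evaluation is the embedding of polynomials into fractions; this
  carries nonvanishing of a polynomial over to the fraction field.\<close>

lemma eval_ratfun_X: "eval_ratfun P ratfun_X = Fract P 1"
proof (induction P)
  case 0
  then show ?case by (simp add: eval_ratfun_def Zero_fract_def)
next
  case (pCons c P)
  then show ?case by (simp add: eval_ratfun_pCons ratfun_X_def)
qed

text \<open>Evaluation is a ring homomorphism and so passes through the determinant. In this form a
  scalar factor of the matrix can be moved to the point of evaluation.\<close>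

lemma eval_ratfun_Char:
  fixes A :: "'k::field mat"
  assumes A: "A \<in> carrier_mat n n"
  shows "eval_ratfun (Char A) Y = det (1\<^sub>m n - Y \<cdot>\<^sub>m map_mat (\<lambda>c. Fract [:c:] 1) A)"
proof -
  interpret ev: comm_ring_hom "\<lambda>P :: 'k poly. eval_ratfun P Y"
    by (rule comm_ring_hom_eval_ratfun)
  have const: "eval_ratfun [:c:] Y = Fract [:c:] 1" for c :: 'k
    by (simp add: eval_ratfun_pCons)
  have X: "eval_ratfun [:0, 1:] Y = Y"
    by (simp add: eval_ratfun_pCons Zero_fract_def[symmetric] One_fract_def[symmetric] flip: one_pCons)
  have "map_mat (\<lambda>P. eval_ratfun P Y) (1\<^sub>m n - [:0, 1:] \<cdot>\<^sub>m map_mat (\<lambda>a. [:a:]) A)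
      = 1\<^sub>m n - Y \<cdot>\<^sub>m map_mat (\<lambda>c. Fract [:c:] 1) A"
    by (rule eq_matI) (use A in \<open>auto simp: ev.hom_minus eval_ratfun_pCons Zero_fract_def[symmetric]\<close>)
  then show ?thesis using A by (simp add: Char_def flip: ev.hom_det)
qed

lemma eval_ratfun_Char_smult:
  fixes A :: "'k::field mat"
  assumes A: "A \<in> carrier_mat n n"
  shows "eval_ratfun (Char (of_nat q \<cdot>\<^sub>m A)) Y = eval_ratfun (Char A) (of_nat q * Y)"
proof -
  interpret c: comm_ring_hom "\<lambda>c :: 'k. Fract [:c:] 1" by (rule comm_ring_hom_const_ratfun)
  have "Y \<cdot>\<^sub>m map_mat (\<lambda>c. Fract [:c:] 1) (of_nat q \<cdot>\<^sub>m A)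
      = (of_nat q * Y) \<cdot>\<^sub>m map_mat (\<lambda>c. Fract [:c:] 1) A"
    by (rule eq_matI) (use A in \<open>auto simp: c.hom_mult c.hom_of_nat\<close>)
  then show ?thesis using A by (simp add: eval_ratfun_Char[where n = n])
qed

section \<open>Geometric sums of matrices\<close>

lemma geometric_sum_0 [simp]:
  fixes A :: "'k::field mat"
  shows "geometric_sum n 0 A = 0\<^sub>m n n"
proof -
  interpret ring "ring_mat TYPE('k) n ()" by (rule ring_mat)
  show ?thesis by (simp add: geometric_sum_def ring_mat_simps)
qed

text \<open>Together with \<open>geometric_sum_0\<close> this replaces the \<open>finsum\<close> in
  the matrix ring: everything later about these sums is an induction on the number of terms.\<close>

lemma geometric_sum_Suc:
  fixes A :: "'k::field mat"
  assumes A: "A \<in> carrier_mat n n"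
  shows "geometric_sum n (Suc m) A = A ^\<^sub>m m + geometric_sum n m A"
proof -
  interpret ring "ring_mat TYPE('k) n ()" by (rule ring_mat)
  show ?thesis
    using finsum_insert[of "{..<m}" m "\<lambda>i. A ^\<^sub>m i"] A
    by (simp add: geometric_sum_def ring_mat_simps lessThan_Suc)
qed

lemma geometric_sum_carrier [simp]:
  "A \<in> carrier_mat n n \<Longrightarrow> geometric_sum n m A \<in> carrier_mat n n"
  by (induction m) (auto simp: geometric_sum_Suc)

lemma geometric_sum_similar:
  fixes A :: "'k::field mat"
  assumes "similar_mat_wit A B P Q" "A \<in> carrier_mat n n"
  shows "similar_mat_wit (geometric_sum n m A) (geometric_sum n m B) P Q"
proof -
  note wit = similar_mat_witD2[OF assms(2,1)]
  have "geometric_sum n m A = P * geometric_sum n m B * Q"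
  proof (induction m)
    case (Suc m)
    have "P * (B ^\<^sub>m m + geometric_sum n m B) * Q
        = P * B ^\<^sub>m m * Q + P * geometric_sum n m B * Q"
      using wit by (simp add: mult_add_distrib_mat[where nr = n and n = n and nc = n]
          add_mult_distrib_mat[where nr = n and n = n and nc = n])
    then show ?case
      using Suc wit similar_mat_wit_pow_id[OF assms(1), of m] by (simp add: geometric_sum_Suc)
  qed (use wit in auto)
  then show ?thesis using wit by (intro similar_mat_witI[where n = n]) auto
qed

lemma geometric_sum_mult_minus_one:
  fixes A :: "'k::field mat"
  assumes A: "A \<in> carrier_mat n n"
  shows "geometric_sum n m A * (A - 1\<^sub>m n) = A ^\<^sub>m m - 1\<^sub>m n"
proof (induction m)
  case 0
  then show ?case using A by (intro eq_matI) auto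
next
  case (Suc m)
  have "geometric_sum n (Suc m) A * (A - 1\<^sub>m n)
      = A ^\<^sub>m m * (A - 1\<^sub>m n) + geometric_sum n m A * (A - 1\<^sub>m n)"
    using A by (simp add: geometric_sum_Suc minus_carrier_mat
        add_mult_distrib_mat[where nr = n and n = n and nc = n])
  also have "A ^\<^sub>m m * (A - 1\<^sub>m n) = A ^\<^sub>m Suc m - A ^\<^sub>m m"
    using A by (simp add: mult_minus_distrib_mat[where nr = n and n = n and nc = n])
  finally show ?case using A Suc by (intro eq_matI) auto
qed

lemma geometric_sum_one:
  "geometric_sum n m (1\<^sub>m n :: 'k::field mat) = of_nat m \<cdot>\<^sub>m 1\<^sub>m n"
proof (induction m)
  case (Suc m)
  have "(1\<^sub>m n :: 'k mat) ^\<^sub>m k = 1\<^sub>m n" for k by (induction k) auto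
  then show ?case using Suc by (simp add: geometric_sum_Suc) (intro eq_matI, auto)
qed (intro eq_matI, auto)

section \<open>Block upper triangular matrices\<close>

lemma mult_four_block_upper:
  fixes A :: "'k::field mat"
  assumes "A \<in> carrier_mat d d" "B \<in> carrier_mat d e" "D \<in> carrier_mat e e"
    "A' \<in> carrier_mat d d" "B' \<in> carrier_mat d e" "D' \<in> carrier_mat e e"
  shows "four_block_mat A B (0\<^sub>m e d) D * four_block_mat A' B' (0\<^sub>m e d) D'
    = four_block_mat (A * A') (A * B' + B * D') (0\<^sub>m e d) (D * D')"
  by (subst mult_four_block_mat[of _ d d _ e _ e _ _ d _ e]) (use assms in auto)

text \<open>The upper right block is left existential, since it never enters a determinant or a
  \<open>Char\<close> of a block triangular matrix.\<close>

lemma pow_four_block_upper: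
  fixes A :: "'k::field mat"
  assumes "A \<in> carrier_mat d d" "B \<in> carrier_mat d e" "D \<in> carrier_mat e e"
  shows "\<exists>B' \<in> carrier_mat d e.
    four_block_mat A B (0\<^sub>m e d) D ^\<^sub>m k = four_block_mat (A ^\<^sub>m k) B' (0\<^sub>m e d) (D ^\<^sub>m k)"
proof (induction k)
  case 0
  then show ?case using assms by (intro bexI[of _ "0\<^sub>m d e"]) auto
next
  case (Suc k)
  then obtain B' where "B' \<in> carrier_mat d e"
    "four_block_mat A B (0\<^sub>m e d) D ^\<^sub>m k = four_block_mat (A ^\<^sub>m k) B' (0\<^sub>m e d) (D ^\<^sub>m k)"
    by blast
  then show ?case
    using assms by (intro bexI[of _ "A ^\<^sub>m k * B + B' * D"]) (auto simp: mult_four_block_upper)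
qed

lemma geometric_sum_four_block_upper:
  fixes A :: "'k::field mat"
  assumes "A \<in> carrier_mat d d" "B \<in> carrier_mat d e" "D \<in> carrier_mat e e"
  shows "\<exists>B' \<in> carrier_mat d e. geometric_sum (d + e) m (four_block_mat A B (0\<^sub>m e d) D)
    = four_block_mat (geometric_sum d m A) B' (0\<^sub>m e d) (geometric_sum e m D)"
proof (induction m)
  case 0
  then show ?case by (intro bexI[of _ "0\<^sub>m d e"]) auto
next
  case (Suc m)
  then obtain B1 where B1: "B1 \<in> carrier_mat d e"
    "geometric_sum (d + e) m (four_block_mat A B (0\<^sub>m e d) D)
      = four_block_mat (geometric_sum d m A) B1 (0\<^sub>m e d) (geometric_sum e m D)"
    by blast
  obtain B2 where "B2 \<in> carrier_mat d e"
    "four_block_mat A B (0\<^sub>m e d) D ^\<^sub>m m = four_block_mat (A ^\<^sub>m m) B2 (0\<^sub>m e d) (D ^\<^sub>m m)"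
    using pow_four_block_upper[OF assms] by blast
  then show ?case
    using assms B1 by (intro bexI[of _ "B2 + B1"])
      (auto simp: geometric_sum_Suc add_four_block_mat[where ?nr1.0 = d and ?nr2.0 = e
        and ?nc1.0 = d and ?nc2.0 = e])
qed

lemma four_block_mat_lower_right_eq:
  assumes eq: "four_block_mat A B C D = four_block_mat A' B' C' D'"
    and "A \<in> carrier_mat d d" "A' \<in> carrier_mat d d" "D \<in> carrier_mat e e" "D' \<in> carrier_mat e e"
  shows "D = D'"
proof (rule eq_matI)
  fix i j assume "i < dim_row D'" "j < dim_col D'"
  then show "D $$ (i, j) = D' $$ (i, j)"
    using assms(2-) arg_cong[OF eq, of "\<lambda>M. M $$ (i + d, j + d)"] by simp
qed (use assms in auto)

text \<open>The situation on the quotient by the invariants, where \<sigma> - 1 is invertible.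
  Telescoping and \<open>comm\<close> give
  \<open>Fr * N * T = Fr * (\<sigma> ^\<^sub>m q - 1) = T * Fr\<close>; cancelling determinants
  yields the first claim, and inverting \<open>T\<close> the second.\<close>

lemma geometric_sum_frobenius:
  fixes \<sigma> Fr :: "'k::field mat"
  assumes \<sigma>: "\<sigma> \<in> carrier_mat n n" and Fr: "Fr \<in> carrier_mat n n"
    and det: "det (\<sigma> - 1\<^sub>m n) \<noteq> 0" "det Fr \<noteq> 0"
    and comm: "\<sigma> * Fr = Fr * \<sigma> ^\<^sub>m q"
  shows "det (geometric_sum n q \<sigma>) = 1" "Char (geometric_sum n q \<sigma> * Fr) = Char Fr"
proof -
  define N T where "N = geometric_sum n q \<sigma>" and "T = \<sigma> - 1\<^sub>m n"
  have carr: "N \<in> carrier_mat n n" "T \<in> carrier_mat n n" "Fr \<in> carrier_mat n n"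
    "\<sigma> \<in> carrier_mat n n"
    using \<sigma> Fr by (auto simp: N_def T_def minus_carrier_mat)
  \<comment> \<open>Conjugation by \<open>P\<close> exchanges \<open>A * P\<close> and
    \<open>P * A\<close>. It is needed because the relation controls \<open>Fr * N\<close>, whereas
    the claim is about \<open>N * Fr\<close>.\<close>
  have sim: "similar_mat (P * A) (A * P)"
    if "det P \<noteq> 0" "P \<in> carrier_mat n n" "A \<in> carrier_mat n n" for P A :: "'k mat"
  proof -
    have "P \<in> Units (ring_mat TYPE('k) n ())" using that by (simp add: det_non_zero_imp_unit)
    then obtain Q where Q: "Q \<in> carrier_mat n n" "Q * P = 1\<^sub>m n" "P * Q = 1\<^sub>m n"
      by (auto simp: Units_def ring_mat_simps)
    then have "P * A = P * (A * P) * Q"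
      using that by (simp add: assoc_mult_mat[where ?n\<^sub>1 = n and ?n\<^sub>2 = n and ?n\<^sub>3 = n and ?n\<^sub>4 = n])
    then show ?thesis using that Q by (intro similar_matI[of _ _ P Q n]) auto
  qed
  have "Fr * N * T = Fr * (\<sigma> ^\<^sub>m q - 1\<^sub>m n)"
    using geometric_sum_mult_minus_one[OF \<sigma>, of q] unfolding N_def[symmetric] T_def[symmetric]
    using carr by (simp add: assoc_mult_mat[of Fr n n N n T n])
  also have "\<dots> = \<sigma> * Fr - Fr"
    using \<sigma> Fr by (simp add: comm mult_minus_distrib_mat[where nr = n and n = n and nc = n])
  also have "\<dots> = T * Fr"
    using \<sigma> Fr by (simp add: T_def minus_mult_distrib_mat[where nr = n and n = n and nc = n])
  finally have FNT: "Fr * N * T = T * Fr" .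
  moreover have "det (Fr * N * T) = det (Fr * N) * det T" "det (Fr * N) = det Fr * det N"
    "det (T * Fr) = det T * det Fr"
    by (rule det_mult[where n = n]; use carr in auto)+
  ultimately have "det Fr * det N * det T = det T * det Fr" by metis
  then show "det (geometric_sum n q \<sigma>) = 1" using det by (simp add: N_def T_def)
  have "T \<in> Units (ring_mat TYPE('k) n ())"
    using det carr by (simp add: det_non_zero_imp_unit flip: T_def)
  then obtain Q where Q: "Q \<in> carrier_mat n n" "Q * T = 1\<^sub>m n" "T * Q = 1\<^sub>m n"
    by (auto simp: Units_def ring_mat_simps)
  have "Fr * N * T * Q = Fr * N * (T * Q)"
    by (rule assoc_mult_mat[of _ n n _ n _ n]) (use Q carr in auto)
  also have "\<dots> = Fr * N" unfolding Q(3) using carr by (simp add: right_mult_one_mat[of _ n])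
  finally have "Fr * N = T * Fr * Q" by (simp only: FNT)
  then have "similar_mat (Fr * N) Fr"
    using Q carr by (intro similar_matI[of _ _ T Q n]) auto
  then have "similar_mat (N * Fr) Fr"
    using sim[of Fr N] det by (metis carr(1,3) similar_mat_sym similar_mat_trans)
  then show "Char (geometric_sum n q \<sigma> * Fr) = Char Fr" by (simp add: Char_similar N_def)
qed


section \<open>Bases adapted to a stable subspace\<close>

context vec_space
begin

lemma lin_indpt_extend:
  assumes "distinct bs" "set bs \<subseteq> carrier_vec n" "lin_indpt (set bs)"
  obtains cs where "distinct (bs @ cs)" "set (bs @ cs) \<subseteq> carrier_vec n" "lin_indpt (set (bs @ cs))"
    "length (bs @ cs) = n"
proof -
  let ?P = "\<lambda>A. A \<subseteq> carrier_vec n \<and> lin_indpt A \<and> set bs \<subseteq> A"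
  have "\<exists>A. finite A \<and> maximal A ?P"
  proof (rule maximal_exists)
    show "finite A \<and> card A \<le> dim" if "?P A" for A
      using that li_le_dim[OF fin_dim, of A] by auto
    show "?P (set bs)" using assms by blast
  qed
  then obtain A where A: "finite A" "maximal A ?P" by blast
  then have PA: "?P A" by (simp add: maximal_def)
  \<comment> \<open>Any independent set containing \<open>A\<close> also contains \<open>bs\<close>,
    so maximality among the independent supersets of \<open>bs\<close> is maximality among all
    independent sets.\<close>
  have "maximal A (\<lambda>S. S \<subseteq> carrier_vec n \<and> lin_indpt S)"
    using A PA unfolding maximal_def by blast
  then have "basis A" by (rule max_li_is_basis)
  then have card: "card A = n" using dim_basis[OF A(1)] dim_is_n by simp
  obtain cs where cs: "set cs = A - set bs" "distinct cs"
    using finite_distinct_list[of "A - set bs"] A(1) by auto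
  then have "distinct (bs @ cs)" "set (bs @ cs) = A" using assms PA by auto
  then show ?thesis using PA card distinct_card[of "bs @ cs"] by (intro that) auto
qed

lemma det_mat_of_cols_lin_indpt:
  assumes "distinct xs" "set xs \<subseteq> carrier_vec n" "lin_indpt (set xs)" "length xs = n"
  shows "det (mat_of_cols n xs) \<noteq> 0"
proof -
  have carr: "mat_of_cols n xs \<in> carrier_mat n n" using assms(4) by auto
  moreover have "cols (mat_of_cols n xs) = xs" using assms(2) by simp
  ultimately have "rank (mat_of_cols n xs) = n" using assms by (simp add: lin_indpt_full_rank)
  then show ?thesis using det_rank_iff[OF carr] by simp
qed

lemma span_set_mat_of_cols:
  assumes xs: "set xs \<subseteq> carrier_vec n" and x: "x \<in> span (set xs)"
  obtains c where "c \<in> carrier_vec (length xs)" "x = mat_of_cols n xs *\<^sub>v c"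
proof -
  have "x \<in> span_list xs" using x span_list_as_span[OF xs] by simp
  then obtain f where "x = lincomb_list f xs" by (auto simp: span_list_def)
  moreover have "\<forall>w\<in>set xs. dim_vec w = n" using xs by auto
  ultimately have "x = mat_of_cols n xs *\<^sub>v vec (length xs) f"
    using lincomb_list_as_mat_mult[of xs f] by simp
  then show ?thesis by (intro that) auto
qed

end

text \<open>Identifies the subspace spanned by \<open>bs\<close> with the vectors whose last
  coordinates vanish; it supplies the hypothesis \<open>PB\<close> of
  \<open>mat_basis_change_four_block\<close>.\<close>

lemma mat_of_cols_append_mult_vec:
  fixes bs cs :: "'k::field vec list"
  assumes "set bs \<subseteq> carrier_vec n" "set cs \<subseteq> carrier_vec n" "c \<in> carrier_vec (length bs)"
  shows "mat_of_cols n (bs @ cs) *\<^sub>v (c @\<^sub>v 0\<^sub>v (length cs)) = mat_of_cols n bs *\<^sub>v c"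
proof (rule eq_vecI)
  fix i assume "i < dim_vec (mat_of_cols n bs *\<^sub>v c)"
  then have i: "i < n" by simp
  have "row (mat_of_cols n (bs @ cs)) i = row (mat_of_cols n bs) i @\<^sub>v row (mat_of_cols n cs) i"
    by (rule eq_vecI) (use i in \<open>auto simp: mat_of_cols_index nth_append\<close>)
  moreover have "row (mat_of_cols n bs) i \<in> carrier_vec (length bs)"
    "row (mat_of_cols n cs) i \<in> carrier_vec (length cs)"
    by (auto intro: carrier_vecI)
  ultimately have "row (mat_of_cols n (bs @ cs)) i \<bullet> (c @\<^sub>v 0\<^sub>v (length cs))
      = row (mat_of_cols n bs) i \<bullet> c + row (mat_of_cols n cs) i \<bullet> 0\<^sub>v (length cs)"
    using assms by (simp add: scalar_prod_append[where ?n1.0 = "length bs" and ?n2.0 = "length cs"])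
  then show "(mat_of_cols n (bs @ cs) *\<^sub>v (c @\<^sub>v 0\<^sub>v (length cs))) $ i
      = (mat_of_cols n bs *\<^sub>v c) $ i"
    using i by simp
qed simp

lemma mat_unit_vec_col:
  fixes A :: "'k::field mat"
  shows "A \<in> carrier_mat nr nc \<Longrightarrow> j < nc \<Longrightarrow> A *\<^sub>v unit_vec nc j = col A j"
  by (intro eq_vecI) auto

text \<open>\<open>P\<close> is known only on vectors supported in the first \<open>d\<close>
  coordinates, and that determines the first \<open>d\<close> columns: there \<open>A\<close> acts
  through \<open>B\<close> by \<open>M\<close>, and \<open>Q\<close> reads the coordinates back.
  Applied both to \<sigma>, with \<open>M\<close> the identity, and to \<open>Fr\<close>.\<close>

lemma mat_basis_change_four_block:
  fixes A :: "'k::field mat"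
  assumes A: "A \<in> carrier_mat (d + e) (d + e)" and B: "B \<in> carrier_mat (d + e) d"
    and M: "M \<in> carrier_mat d d" and AB: "A * B = B * M"
    and P: "P \<in> carrier_mat (d + e) (d + e)" and Q: "Q \<in> carrier_mat (d + e) (d + e)"
    and QP: "Q * P = 1\<^sub>m (d + e)"
    and PB: "\<And>c. c \<in> carrier_vec d \<Longrightarrow> P *\<^sub>v (c @\<^sub>v 0\<^sub>v e) = B *\<^sub>v c"
  obtains C D where "C \<in> carrier_mat d e" "D \<in> carrier_mat e e"
    "Q * A * P = four_block_mat M C (0\<^sub>m e d) D"
proof -
  let ?G = "Q * A * P"
  let ?n = "d + e"
  obtain A1 A2 A3 A4 where split: "split_block ?G d d = (A1, A2, A3, A4)"
    by (cases "split_block ?G d d") auto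
  have dims: "dim_row ?G = d + e" "dim_col ?G = d + e" using P Q by auto
  note blocks = split_block[OF split dims]
  have col: "col ?G j = col M j @\<^sub>v 0\<^sub>v e" if j: "j < d" for j
  proof -
    define u where "u = unit_vec d j @\<^sub>v (0\<^sub>v e :: 'k vec)"
    have u: "u = unit_vec ?n j"
      unfolding u_def by (rule eq_vecI) (use j in \<open>auto simp: unit_vec_def\<close>)
    have uc: "u \<in> carrier_vec ?n" by (simp add: u)
    have mj: "col M j @\<^sub>v 0\<^sub>v e \<in> carrier_vec ?n" using M by auto
    have "col ?G j = ?G *\<^sub>v u"
      unfolding u by (rule mat_unit_vec_col[symmetric]) (use dims j in \<open>auto intro: carrier_matI\<close>)
    also have "\<dots> = Q *\<^sub>v (A *\<^sub>v (P *\<^sub>v u))"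
      using A P Q uc by (simp add: assoc_mult_mat_vec[of _ ?n ?n _ ?n])
    also have "P *\<^sub>v u = B *\<^sub>v unit_vec d j" unfolding u_def by (rule PB) simp
    also have "A *\<^sub>v (B *\<^sub>v unit_vec d j) = B *\<^sub>v (M *\<^sub>v unit_vec d j)"
      using assoc_mult_mat_vec[OF A B, of "unit_vec d j"] assoc_mult_mat_vec[OF B M, of "unit_vec d j"] AB
      by simp
    also have "M *\<^sub>v unit_vec d j = col M j" using M j by (simp add: mat_unit_vec_col[of _ d d])
    also have "B *\<^sub>v col M j = P *\<^sub>v (col M j @\<^sub>v 0\<^sub>v e)" using M by (intro PB[symmetric]) auto
    also have "Q *\<^sub>v (P *\<^sub>v (col M j @\<^sub>v 0\<^sub>v e)) = col M j @\<^sub>v 0\<^sub>v e"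
      using assoc_mult_mat_vec[OF Q P mj] mj by (simp add: QP)
    finally show ?thesis .
  qed
  have entry: "?G $$ (i, j) = (if i < d then M $$ (i, j) else 0)" if "i < ?n" "j < d" for i j
  proof -
    have "?G $$ (i, j) = col ?G j $ i" using that dims by simp
    then show ?thesis using that M by (simp add: col)
  qed
  have "A1 = M"
    by (rule eq_matI) (use split dims M entry in \<open>auto simp: split_block_def Let_def\<close>)
  moreover have "A3 = 0\<^sub>m e d"
    by (rule eq_matI) (use split dims M entry in \<open>auto simp: split_block_def Let_def\<close>)
  ultimately show ?thesis using blocks by (intro that[of A2 A4]) auto
qed


lemma minus_one_mat_kernel_iff:
  fixes A :: "'k::field mat"
  assumes A: "A \<in> carrier_mat n n" and x: "x \<in> carrier_vec n"
  shows "(A - 1\<^sub>m n) *\<^sub>v x = 0\<^sub>v n \<longleftrightarrow> A *\<^sub>v x = x"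
proof -
  have "(A - 1\<^sub>m n) *\<^sub>v x = A *\<^sub>v x - x"
    using A x by (simp add: minus_mult_distrib_mat_vec[of _ n n])
  moreover have "A *\<^sub>v x - x = 0\<^sub>v n \<longleftrightarrow> A *\<^sub>v x = x"
    using A x by (auto simp: vec_eq_iff)
  ultimately show ?thesis by simp
qed

lemma conj_mat_mult:
  fixes A B P Q :: "'k::field mat"
  assumes "A \<in> carrier_mat n n" "B \<in> carrier_mat n n" "P \<in> carrier_mat n n" "Q \<in> carrier_mat n n"
    and PQ: "P * Q = 1\<^sub>m n"
  shows "Q * A * P * (Q * B * P) = Q * (A * B) * P"
proof -
  have carr: "Q * A \<in> carrier_mat n n" "Q * B \<in> carrier_mat n n" "B * P \<in> carrier_mat n n"
    using assms by auto
  have "Q * A * P * (Q * B * P) = Q * A * (P * (Q * (B * P)))"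
    using assms carr by (simp add: assoc_mult_mat[where ?n\<^sub>1.0 = n and ?n\<^sub>2.0 = n and ?n\<^sub>3.0 = n
        and ?n\<^sub>4.0 = n])
  also have "P * (Q * (B * P)) = P * Q * (B * P)"
    by (rule assoc_mult_mat[symmetric]) (use assms carr in auto)
  also have "\<dots> = B * P" unfolding PQ by (rule left_mult_one_mat) (rule carr)
  also have "Q * A * (B * P) = Q * (A * B) * P"
    using assms carr by (simp add: assoc_mult_mat[where ?n\<^sub>1.0 = n and ?n\<^sub>2.0 = n and ?n\<^sub>3.0 = n
        and ?n\<^sub>4.0 = n])
  finally show ?thesis .
qed

lemma similar_mat_wit_conj:
  fixes A P Q :: "'k::field mat"
  assumes "A \<in> carrier_mat n n" "P \<in> carrier_mat n n" "Q \<in> carrier_mat n n"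
    and "P * Q = 1\<^sub>m n" "Q * P = 1\<^sub>m n"
  shows "similar_mat_wit (Q * A * P) A Q P"
  by (rule similar_mat_witI[where n = n]) (use assms in auto)

text \<open>If 1 were an eigenvalue of \<open>Y\<close> with eigenvector \<open>y\<close>, the
  vector with coordinates 0 and \<open>y\<close> would be moved only inside the first block, by
  \<open>E *\<^sub>v y\<close>. The hypothesis \<open>ker\<close> excludes such vectors.\<close>

lemma det_minus_one_four_block:
  fixes Y :: "'k::field mat"
  assumes E: "E \<in> carrier_mat d e" and Y: "Y \<in> carrier_mat e e"
    and ker: "\<And>a y. a \<in> carrier_vec d \<Longrightarrow> y \<in> carrier_vec e \<Longrightarrow>
      four_block_mat (1\<^sub>m d) E (0\<^sub>m e d) Y *\<^sub>v (0\<^sub>v d @\<^sub>v y) = a @\<^sub>v y \<Longrightarrow> y = 0\<^sub>v e"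
  shows "det (Y - 1\<^sub>m e) \<noteq> 0"
proof
  assume "det (Y - 1\<^sub>m e) = 0"
  then obtain y where y: "y \<in> carrier_vec e" "y \<noteq> 0\<^sub>v e" "(Y - 1\<^sub>m e) *\<^sub>v y = 0\<^sub>v e"
    using det_0_iff_vec_prod_zero_field[of "Y - 1\<^sub>m e" e] Y by (auto simp: minus_carrier_mat)
  have Yy: "Y *\<^sub>v y = y" using y Y by (simp add: minus_one_mat_kernel_iff)
  have "four_block_mat (1\<^sub>m d) E (0\<^sub>m e d) Y *\<^sub>v (0\<^sub>v d @\<^sub>v y) = (E *\<^sub>v y) @\<^sub>v y"
    by (subst four_block_mat_mult_vec[of _ d d _ e _ e]) (use E Y y Yy in auto)
  then show False using ker[of "E *\<^sub>v y" y] E y Yy by auto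
qed

text \<open>The linear algebra, detached from the Weil group. Hypothesis \<open>ker\<close> is what
  semisimplicity provides: \<sigma> - 1 and its square have the same kernel. \<open>D\<close> is the
  matrix of \<open>Fr\<close> on the quotient by that kernel, and both \<open>Char\<close>
  polynomials have \<open>Char D\<close> as a factor.\<close>

lemma Char_geometric_sum_frobenius:
  fixes \<sigma> Fr :: "'k::field mat"
  assumes \<sigma>: "\<sigma> \<in> carrier_mat n n" and Fr: "Fr \<in> carrier_mat n n" and det: "det Fr \<noteq> 0"
    and comm: "\<sigma> * Fr = Fr * \<sigma> ^\<^sub>m q"
    and ker: "\<And>x. x \<in> carrier_vec n \<Longrightarrow> \<sigma> *\<^sub>v (\<sigma> *\<^sub>v x - x) = \<sigma> *\<^sub>v x - x \<Longrightarrow> \<sigma> *\<^sub>v x = x"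
    and bs: "distinct bs" "vectorspace.basis class_ring (subspace_of_vec n (mat_kernel (\<sigma> - 1\<^sub>m n))) (set bs)"
    and M: "M \<in> carrier_mat (length bs) (length bs)" "Fr * mat_of_cols n bs = mat_of_cols n bs * M"
  obtains e D where "D \<in> carrier_mat e e" "Char Fr = Char M * Char D"
    "Char (geometric_sum n q \<sigma> * Fr) = Char (of_nat q \<cdot>\<^sub>m M) * Char D"
    "det (geometric_sum n q \<sigma>) = of_nat q ^ length bs"
proof -
  interpret kernel n n "\<sigma> - 1\<^sub>m n" using \<sigma> by unfold_locales (simp add: minus_carrier_mat)
  have bs_ker: "set bs \<subseteq> mat_kernel (\<sigma> - 1\<^sub>m n)" and li: "Ker.lin_indpt (set bs)"
    and span: "span (set bs) = mat_kernel (\<sigma> - 1\<^sub>m n)"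
    using bs(2) unfolding Ker.basis_def by auto
  have ker_iff: "x \<in> mat_kernel (\<sigma> - 1\<^sub>m n) \<longleftrightarrow> x \<in> carrier_vec n \<and> \<sigma> *\<^sub>v x = x" for x
    using minus_one_mat_kernel_iff[OF \<sigma>, of x] by (auto simp: mat_kernel[OF A])
  have bs_carr: "set bs \<subseteq> carrier_vec n" using bs_ker ker_iff by auto
  have "NC.lin_indpt (set bs)" using li lindep_same[OF bs_ker] by simp
  then obtain cs where cs: "distinct (bs @ cs)" "set (bs @ cs) \<subseteq> carrier_vec n"
    "NC.lin_indpt (set (bs @ cs))" "length (bs @ cs) = n"
    using NC.lin_indpt_extend[OF bs(1) bs_carr] by blast
  define d e P B where defs: "d = length bs" "e = length cs" "P = mat_of_cols n (bs @ cs)"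
    "B = mat_of_cols n bs"
  have de: "d + e = n" using cs(4) by (simp add: defs)
  have P: "P \<in> carrier_mat n n" and B: "B \<in> carrier_mat n d" using cs(4) by (auto simp: defs)
  have "det P \<noteq> 0" unfolding defs by (rule NC.det_mat_of_cols_lin_indpt) (use cs in auto)
  then have "P \<in> Units (ring_mat TYPE('k) n ())" using P by (simp add: det_non_zero_imp_unit)
  then obtain Q where Q: "Q \<in> carrier_mat n n" and QP: "Q * P = 1\<^sub>m n" and PQ: "P * Q = 1\<^sub>m n"
    by (auto simp: Units_def ring_mat_simps)
  have PB: "P *\<^sub>v (c @\<^sub>v 0\<^sub>v e) = B *\<^sub>v c" if "c \<in> carrier_vec d" for c
    unfolding defs by (rule mat_of_cols_append_mult_vec) (use bs_carr cs that in \<open>auto simp: defs\<close>)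
  have MB: "Fr * B = B * M" "M \<in> carrier_mat d d" using M by (auto simp: defs)
  \<comment> \<open>The columns of \<open>B\<close> are fixed by \<sigma>, so the upper left block
    of \<sigma> in the new basis is the identity.\<close>
  have "\<sigma> * B = B * 1\<^sub>m d"
  proof (rule mat_col_eqI)
    fix j assume "j < dim_col (B * 1\<^sub>m d)"
    then have j: "j < length bs" by (simp add: defs)
    then have "bs ! j \<in> mat_kernel (\<sigma> - 1\<^sub>m n)" using bs_ker by auto
    then show "col (\<sigma> * B) j = col (B * 1\<^sub>m d) j"
      using j B \<sigma> by (simp add: ker_iff col_mult2[of _ n n _ d] defs)
  qed (use B \<sigma> in auto)
  then obtain E Y where E: "E \<in> carrier_mat d e" and Y: "Y \<in> carrier_mat e e"
    and \<sigma>1: "Q * \<sigma> * P = four_block_mat (1\<^sub>m d) E (0\<^sub>m e d) Y"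
    using mat_basis_change_four_block[of \<sigma> d e B "1\<^sub>m d" P Q] \<sigma> B P Q QP PB by (auto simp: de)
  obtain C D where C: "C \<in> carrier_mat d e" and D: "D \<in> carrier_mat e e"
    and Fr1: "Q * Fr * P = four_block_mat M C (0\<^sub>m e d) D"
    using mat_basis_change_four_block[of Fr d e B M P Q] Fr B P Q QP PB MB by (auto simp: de)
  note sim\<sigma> = similar_mat_wit_conj[OF \<sigma> P Q PQ QP]
  have pow: "(Q * \<sigma> * P) ^\<^sub>m q = Q * \<sigma> ^\<^sub>m q * P"
    using similar_mat_wit_pow_id[OF sim\<sigma>] by simp
  \<comment> \<open>The commutation relation descends to the quotient: it is conjugated into the new
    basis, and the lower right blocks are compared.\<close>
  have YD: "Y * D = D * Y ^\<^sub>m q"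
  proof -
    obtain E' where E': "E' \<in> carrier_mat d e"
      "(Q * \<sigma> * P) ^\<^sub>m q = four_block_mat (1\<^sub>m d ^\<^sub>m q) E' (0\<^sub>m e d) (Y ^\<^sub>m q)"
      unfolding \<sigma>1 using pow_four_block_upper[OF one_carrier_mat E Y] by blast
    have "Q * \<sigma> * P * (Q * Fr * P) = Q * Fr * P * (Q * \<sigma> * P) ^\<^sub>m q"
      unfolding pow using \<sigma> Fr P Q PQ comm by (simp only: conj_mat_mult pow_carrier_mat)
    then have "four_block_mat (1\<^sub>m d * M) (1\<^sub>m d * C + E * D) (0\<^sub>m e d) (Y * D)
        = four_block_mat (M * 1\<^sub>m d ^\<^sub>m q) (M * E' + C * Y ^\<^sub>m q) (0\<^sub>m e d) (D * Y ^\<^sub>m q)"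
      unfolding E' Fr1 unfolding \<sigma>1 using E Y C D MB E' by (simp only: mult_four_block_upper
          one_carrier_mat pow_carrier_mat)
    then show ?thesis
      by (rule four_block_mat_lower_right_eq) (use MB Y D in auto)
  qed
  have "det (Q * Fr * P) = det Fr"
    by (rule det_similar) (use similar_mat_wit_conj[OF Fr P Q PQ QP] in \<open>auto simp: similar_mat_def\<close>)
  then have detD: "det D \<noteq> 0"
    using det det_four_block_mat_lower_left_zero[OF MB(2) C refl D] by (auto simp: Fr1)
  have detY: "det (Y - 1\<^sub>m e) \<noteq> 0"
  proof (rule det_minus_one_four_block[OF E Y])
    fix a y assume a: "a \<in> carrier_vec d" and y: "y \<in> carrier_vec e"
      and eq: "four_block_mat (1\<^sub>m d) E (0\<^sub>m e d) Y *\<^sub>v (0\<^sub>v d @\<^sub>v y) = a @\<^sub>v y"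
    \<comment> \<open>In the old coordinates \<open>eq\<close> says that \<sigma> moves
      \<open>x\<close> by \<open>B *\<^sub>v a\<close>, a fixed vector. So \<open>ker\<close> makes
      \<open>x\<close> itself fixed; then \<open>x\<close> lies in the span of \<open>bs\<close>,
      and its last coordinates \<open>y\<close> vanish.\<close>
    define z x where "z = 0\<^sub>v d @\<^sub>v y" and "x = P *\<^sub>v z"
    have z: "z \<in> carrier_vec n" unfolding z_def de[symmetric] using y by (intro append_carrier_vec) auto
    have az: "a @\<^sub>v 0\<^sub>v e \<in> carrier_vec n" unfolding de[symmetric] using a by (intro append_carrier_vec) auto
    have x: "x \<in> carrier_vec n" using P z by (simp add: x_def)
    have "\<sigma> *\<^sub>v x = P *\<^sub>v (Q *\<^sub>v (\<sigma> *\<^sub>v x))"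
      using assoc_mult_mat_vec[OF P Q, of "\<sigma> *\<^sub>v x"] \<sigma> x by (simp add: PQ)
    also have "Q *\<^sub>v (\<sigma> *\<^sub>v x) = Q * \<sigma> * P *\<^sub>v z"
      using \<sigma> P Q z by (simp add: x_def assoc_mult_mat_vec[of _ n n _ n])
    also have "\<dots> = a @\<^sub>v y" using eq by (simp add: \<sigma>1 z_def)
    also have "a @\<^sub>v y = (a @\<^sub>v 0\<^sub>v e) + z"
      unfolding z_def using a y by (intro eq_vecI) auto
    also have "P *\<^sub>v \<dots> = B *\<^sub>v a + x"
      using mult_add_distrib_mat_vec[OF P az z] PB[OF a] by (simp add: x_def)
    finally have \<sigma>x: "\<sigma> *\<^sub>v x = B *\<^sub>v a + x" .
    have \<sigma>B: "\<sigma> *\<^sub>v (B *\<^sub>v a) = B *\<^sub>v a"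
      using \<open>\<sigma> * B = B * 1\<^sub>m d\<close> assoc_mult_mat_vec[OF \<sigma> B a] B by simp
    have diff: "B *\<^sub>v a + x - x = B *\<^sub>v a" using B a x by (intro eq_vecI) auto
    have "\<sigma> *\<^sub>v x = x" by (rule ker[OF x]) (simp only: \<sigma>x diff \<sigma>B)
    then have "x \<in> NC.span (set bs)" using x span span_same[OF bs_ker] by (simp add: ker_iff)
    then obtain c where c: "c \<in> carrier_vec d" "x = B *\<^sub>v c"
      using NC.span_set_mat_of_cols[OF bs_carr] by (auto simp: defs)
    have cz: "c @\<^sub>v 0\<^sub>v e \<in> carrier_vec n" unfolding de[symmetric] using c by (intro append_carrier_vec) auto
    have "Q *\<^sub>v (P *\<^sub>v z) = Q *\<^sub>v (P *\<^sub>v (c @\<^sub>v 0\<^sub>v e))" using c PB by (simp add: x_def)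
    then have "z = c @\<^sub>v 0\<^sub>v e"
      using assoc_mult_mat_vec[OF Q P z] assoc_mult_mat_vec[OF Q P cz] z cz by (simp add: QP)
    then show "y = 0\<^sub>v e" unfolding z_def using append_vec_eq[OF zero_carrier_vec c(1)] by blast
  qed
  note frob = geometric_sum_frobenius[OF Y D detY detD YD]
  have geom1: "geometric_sum d q (1\<^sub>m d) = of_nat q \<cdot>\<^sub>m (1\<^sub>m d :: 'k mat)" by (rule geometric_sum_one)
  obtain X2 where X2: "X2 \<in> carrier_mat d e" and gs: "geometric_sum n q (Q * \<sigma> * P)
      = four_block_mat (of_nat q \<cdot>\<^sub>m 1\<^sub>m d) X2 (0\<^sub>m e d) (geometric_sum e q Y)"
    using geometric_sum_four_block_upper[OF one_carrier_mat E Y, of q] unfolding \<sigma>1 de geom1 by blast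
  let ?N = "geometric_sum n q \<sigma>"
  have N: "?N \<in> carrier_mat n n" using \<sigma> by simp
  have Q\<sigma>P: "Q * \<sigma> * P \<in> carrier_mat n n" using \<sigma> P Q by auto
  have wit: "similar_mat_wit (geometric_sum n q (Q * \<sigma> * P)) ?N Q P"
    by (rule geometric_sum_similar[OF sim\<sigma> Q\<sigma>P])
  have gs_conj: "geometric_sum n q (Q * \<sigma> * P) = Q * ?N * P"
    by (rule similar_mat_witD2(3)[OF geometric_sum_carrier[OF Q\<sigma>P] wit])
  have gs_sim: "similar_mat (geometric_sum n q (Q * \<sigma> * P)) ?N"
    using wit by (auto simp: similar_mat_def)
  have "det ?N = det (geometric_sum n q (Q * \<sigma> * P))" using det_similar[OF gs_sim] by simp
  also have "\<dots> = of_nat q ^ d"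
    unfolding gs by (subst det_four_block_mat_lower_left_zero[of _ d _ e]) (use X2 Y frob in auto)
  finally have 1: "det ?N = of_nat q ^ length bs" by (simp add: defs)
  have Char_conj: "Char (Q * A * P) = Char A" if "A \<in> carrier_mat n n" for A
    by (rule Char_similar) (use similar_mat_wit_conj[OF that P Q PQ QP] in \<open>auto simp: similar_mat_def\<close>)
  have 2: "Char Fr = Char M * Char D"
    using Char_conj[OF Fr] Char_four_block_upper[OF MB(2) C D] by (simp add: Fr1)
  have "Char (?N * Fr) = Char (Q * (?N * Fr) * P)" using N Fr by (simp add: Char_conj)
  also have "Q * (?N * Fr) * P = geometric_sum n q (Q * \<sigma> * P) * (Q * Fr * P)"
    unfolding gs_conj using N Fr P Q PQ by (simp only: conj_mat_mult)
  also have "\<dots> = four_block_mat (of_nat q \<cdot>\<^sub>m 1\<^sub>m d * M) (of_nat q \<cdot>\<^sub>m 1\<^sub>m d * C + X2 * D)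
      (0\<^sub>m e d) (geometric_sum e q Y * D)"
    unfolding gs Fr1 by (rule mult_four_block_upper) (use X2 Y MB C D in auto)
  also have "Char \<dots> = Char (of_nat q \<cdot>\<^sub>m 1\<^sub>m d * M) * Char (geometric_sum e q Y * D)"
    by (rule Char_four_block_upper) (use X2 Y MB C D in \<open>auto intro!: mult_carrier_mat[of _ e e]\<close>)
  also have "of_nat q \<cdot>\<^sub>m 1\<^sub>m d * M = of_nat q \<cdot>\<^sub>m M"
    using MB by (simp add: mult_smult_assoc_mat[of _ d d])
  finally have 3: "Char (?N * Fr) = Char (of_nat q \<cdot>\<^sub>m M) * Char D" by (simp add: frob)
  show ?thesis by (rule that[OF D 2 3 1])
qed


text \<open>\<open>Char_on\<close> is a choice among all bases. The basis and matrix returned here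
  are ones that witness the chosen value, so the block decomposition can be carried out in exactly
  that basis.\<close>

lemma Char_on_mat_kernel:
  fixes A T :: "'k::field mat"
  assumes Ac: "A \<in> carrier_mat n n" and T: "T \<in> carrier_mat n n"
    and stable: "\<And>x. x \<in> mat_kernel T \<Longrightarrow> A *\<^sub>v x \<in> mat_kernel T"
  obtains bs M where "distinct bs"
    "vectorspace.basis class_ring (subspace_of_vec n (mat_kernel T)) (set bs)"
    "M \<in> carrier_mat (length bs) (length bs)" "A * mat_of_cols n bs = mat_of_cols n bs * M"
    "Char_on n A (mat_kernel T) = Char M" "subspace_dim n (mat_kernel T) = length bs"
proof -
  interpret kernel n n T using T by unfold_locales
  let ?W = "\<lambda>bs M B P. distinct bs \<and>
    vectorspace.basis class_ring (subspace_of_vec n (mat_kernel T)) (set bs) \<and>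
    B = mat_of_cols n bs \<and> M \<in> carrier_mat (length bs) (length bs) \<and> A * B = B * M \<and> P = Char M"
  have "\<exists>bs M B P. ?W bs M B P"
  proof -
    obtain b where b: "finite b" "Ker.basis b" using kernel_basis_exists[OF T] by blast
    then obtain bs where bs: "set bs = b" "distinct bs" using finite_distinct_list by blast
    have ker: "set bs \<subseteq> mat_kernel T" and span: "span (set bs) = mat_kernel T"
      using b bs unfolding Ker.basis_def by auto
    have carr: "set bs \<subseteq> carrier_vec n" using ker mat_kernel_carrier[OF T] by blast
    have "\<exists>c. c \<in> carrier_vec (length bs) \<and> A *\<^sub>v x = mat_of_cols n bs *\<^sub>v c" if "x \<in> set bs" for x
    proof -
      have "A *\<^sub>v x \<in> NC.span (set bs)" using stable that ker span span_same[OF ker] by auto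
      then show ?thesis using NC.span_set_mat_of_cols[OF carr] by blast
    qed
    then obtain c where c: "\<And>x. x \<in> set bs \<Longrightarrow>
        c x \<in> carrier_vec (length bs) \<and> A *\<^sub>v x = mat_of_cols n bs *\<^sub>v c x"
      by metis
    define M where "M = mat_of_cols (length bs) (map c bs)"
    have M: "M \<in> carrier_mat (length bs) (length bs)"
      unfolding M_def using mat_of_cols_carrier(1)[of "length bs" "map c bs"] by simp
    have "A * mat_of_cols n bs = mat_of_cols n bs * M"
    proof (rule mat_col_eqI)
      fix j assume "j < dim_col (mat_of_cols n bs * M)"
      then have j: "j < length bs" using M by simp
      then have cj: "c (bs ! j) \<in> carrier_vec (length bs)" "bs ! j \<in> carrier_vec n"
        using c carr by auto
      have "col (A * mat_of_cols n bs) j = A *\<^sub>v (bs ! j)"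
        using j cj Ac by (simp add: col_mult2[of _ n n _ "length bs"])
      moreover have "col (mat_of_cols n bs * M) j = mat_of_cols n bs *\<^sub>v c (bs ! j)"
        using j cj M by (simp add: col_mult2[of _ n "length bs" _ "length bs"] M_def)
      ultimately show "col (A * mat_of_cols n bs) j = col (mat_of_cols n bs * M) j"
        using c j by simp
    qed (use Ac M in auto)
    then show ?thesis using bs b M by blast
  qed
  then have "\<exists>P bs M B. ?W bs M B P" by blast
  then have "\<exists>bs M B. ?W bs M B (Char_on n A (mat_kernel T))"
    unfolding Char_on_def by (rule someI_ex)
  then obtain bs M where W: "?W bs M (mat_of_cols n bs) (Char_on n A (mat_kernel T))" by blast
  have "subspace_dim n (mat_kernel T) = length bs"
    using W Ker.dim_basis[of "set bs"] distinct_card[of bs] by (simp add: subspace_dim_def)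
  then show ?thesis using W by (intro that[of bs M]) auto
qed

section \<open>Tame semisimple representations\<close>

lemma subspace_vec_iff:
  fixes U :: "'k::field vec set"
  shows "VectorSpace.subspace class_ring U (module_vec TYPE('k) n) \<longleftrightarrow>
    U \<subseteq> carrier_vec n \<and> 0\<^sub>v n \<in> U \<and> (\<forall>x\<in>U. \<forall>y\<in>U. x + y \<in> U) \<and> (\<forall>c. \<forall>x\<in>U. c \<cdot>\<^sub>v x \<in> U)"
  using vec_vs[of n, where 'a = 'k] vec_module[of n, where 'a = 'k]
  by (auto simp: VectorSpace.subspace_def submodule_def module_vec_simps class_ring_simps)

lemma subrep_Int: "subrep W n \<rho> U \<Longrightarrow> subrep W n \<rho> U' \<Longrightarrow> subrep W n \<rho> (U \<inter> U')"
  unfolding subrep_def subspace_vec_iff by (simp add: le_infI1)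

lemma mult_mat_vec_zero:
  fixes A :: "'k::field mat"
  shows "A \<in> carrier_mat nr nc \<Longrightarrow> A *\<^sub>v 0\<^sub>v nc = 0\<^sub>v nr"
  by (intro eq_vecI) auto

lemma mult_mat_vec_finsum:
  fixes T :: "'k::field mat"
  assumes T: "T \<in> carrier_mat n n" and "finite I" "w \<in> I \<rightarrow> carrier_vec n"
  shows "T *\<^sub>v (\<Oplus>\<^bsub>module_vec TYPE('k) n\<^esub>i\<in>I. w i) = (\<Oplus>\<^bsub>module_vec TYPE('k) n\<^esub>i\<in>I. T *\<^sub>v w i)"
proof -
  interpret vec_space "TYPE('k)" n .
  show ?thesis
    using assms(2,3)
  proof (induction I)
    case empty
    then show ?case using T by (simp add: mult_mat_vec_zero)
  next
    case (insert i I)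
    then have "(\<Oplus>\<^bsub>V\<^esub>i\<in>I. w i) \<in> carrier_vec n" by (intro M.finsum_closed) auto
    then show ?case
      using insert T by (simp add: M.finsum_insert mult_add_distrib_mat_vec[of _ n n] Pi_iff)
  qed
qed

text \<open>On an irreducible constituent \<open>T\<close> is either zero or injective.\<close>

lemma semisimple_rep_kernel_square:
  fixes T :: "'k::field mat"
  assumes semi: "semisimple_rep W n \<rho>" and T: "T \<in> carrier_mat n n"
    and stable: "\<And>U u. subrep W n \<rho> U \<Longrightarrow> u \<in> U \<Longrightarrow> T *\<^sub>v u \<in> U"
    and ker: "subrep W n \<rho> {x \<in> carrier_vec n. T *\<^sub>v x = 0\<^sub>v n}"
    and x: "x \<in> carrier_vec n" "T *\<^sub>v (T *\<^sub>v x) = 0\<^sub>v n"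
  shows "T *\<^sub>v x = 0\<^sub>v n"
proof -
  interpret vec_space "TYPE('k)" n .
  let ?K = "{x \<in> carrier_vec n. T *\<^sub>v x = 0\<^sub>v n}"
  obtain k :: nat and U where "\<forall>i<k. irreducible_subrep W n \<rho> (U i)"
    and "\<forall>x\<in>carrier_vec n.
      \<exists>!w. w \<in> (\<Pi>\<^sub>E i\<in>{..<k}. U i) \<and> x = (\<Oplus>\<^bsub>V\<^esub>i\<in>{..<k}. w i)"
    using semi unfolding semisimple_rep_def by (elim exE conjE)
  then have U: "\<And>i. i < k \<Longrightarrow> irreducible_subrep W n \<rho> (U i)"
    and dec: "\<And>x. x \<in> carrier_vec n \<Longrightarrow>
      \<exists>!w. w \<in> (\<Pi>\<^sub>E i\<in>{..<k}. U i) \<and> x = (\<Oplus>\<^bsub>V\<^esub>i\<in>{..<k}. w i)"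
    by simp_all
  have sub: "subrep W n \<rho> (U i)" if "i < k" for i
    using U[OF that] by (simp add: irreducible_subrep_def)
  have Uc: "U i \<subseteq> carrier_vec n" "0\<^sub>v n \<in> U i" if "i < k" for i
    using sub[OF that] by (auto simp: subrep_def subspace_vec_iff)
  obtain w where w: "w \<in> (\<Pi>\<^sub>E i\<in>{..<k}. U i)" and xw: "x = (\<Oplus>\<^bsub>V\<^esub>i\<in>{..<k}. w i)"
    using dec[OF x(1)] by blast
  have wU: "w i \<in> U i" if "i < k" for i using w that by auto
  have wc: "w i \<in> carrier_vec n" if "i < k" for i using wU Uc that by blast
  have Tx: "T *\<^sub>v x = (\<Oplus>\<^bsub>V\<^esub>i\<in>{..<k}. T *\<^sub>v w i)"
    unfolding xw by (rule mult_mat_vec_finsum[OF T]) (auto intro: wc)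
  have TTx: "T *\<^sub>v (T *\<^sub>v x) = (\<Oplus>\<^bsub>V\<^esub>i\<in>{..<k}. T *\<^sub>v (T *\<^sub>v w i))"
    unfolding Tx by (rule mult_mat_vec_finsum[OF T]) (auto intro: mult_mat_vec_carrier[OF T] wc)
  have TTw: "T *\<^sub>v (T *\<^sub>v w i) = 0\<^sub>v n" if i: "i < k" for i
  proof -
    \<comment> \<open>Two decompositions of the zero vector, which must coincide by uniqueness. The
      restricted abstractions put them in the extensional product over which uniqueness is
      stated.\<close>
    define a b where "a = (\<lambda>i\<in>{..<k}. T *\<^sub>v (T *\<^sub>v w i))" and "b = (\<lambda>i\<in>{..<k}. 0\<^sub>v n :: 'k vec)"
    have "(\<Oplus>\<^bsub>V\<^esub>i\<in>{..<k}. a i) = T *\<^sub>v (T *\<^sub>v x)"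
      unfolding TTx by (rule M.finsum_cong') (auto simp: a_def intro: mult_mat_vec_carrier[OF T] wc)
    moreover have "(\<Oplus>\<^bsub>V\<^esub>i\<in>{..<k}. b i) = 0\<^sub>v n" by (rule M.finsum_all0) (simp add: b_def)
    moreover have "a \<in> (\<Pi>\<^sub>E i\<in>{..<k}. U i)" "b \<in> (\<Pi>\<^sub>E i\<in>{..<k}. U i)"
      using stable[OF sub] wU Uc by (auto simp: a_def b_def)
    ultimately have "a = b" using dec[OF zero_carrier_vec] x(2) by metis
    then have "a i = b i" by simp
    then show ?thesis using i by (simp add: a_def b_def)
  qed
  have "T *\<^sub>v w i = 0\<^sub>v n" if i: "i < k" for i
  proof -
    have "subrep W n \<rho> (U i \<inter> ?K)" using sub[OF i] ker by (rule subrep_Int)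
    then have "U i \<inter> ?K = {0\<^sub>v n} \<or> U i \<inter> ?K = U i"
      using U[OF i] unfolding irreducible_subrep_def by blast
    moreover have "T *\<^sub>v w i \<in> U i \<inter> ?K"
      using stable[OF sub[OF i] wU[OF i]] TTw[OF i] T wc[OF i] by auto
    \<comment> \<open>If the intersection is zero, \<open>T *\<^sub>v w i\<close> lies in it and
      vanishes; if it is all of \<open>U i\<close>, then \<open>w i\<close> lies in the
      kernel.\<close>
    ultimately show ?thesis using wU[OF i] by blast
  qed
  then have "(\<Oplus>\<^bsub>V\<^esub>i\<in>{..<k}. T *\<^sub>v w i) = 0\<^sub>v n" by (intro M.finsum_all0) auto
  then show ?thesis by (simp add: Tx)
qed

section \<open>The topology of the tame quotient and the invariants of inertia\<close>

context padic_field_in_closure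
begin

lemma subgroup_wild_inertia: "subgroup (wild_inertia v F) (automorphism_group (inertia v F))"
  using wild_inertia_normal by (rule normal_imp_subgroup)

text \<open>The constructor \<open>topology\<close> yields the intended open sets once they are
  known to form a topology. The point to check is intersections: distinct cosets are disjoint, so
  the union of an intersection of families is the intersection of their unions.\<close>

lemma openin_tame_topology:
  "openin (tame_topology v F) U \<longleftrightarrow> U \<subseteq> carrier (tame_quotient v F) \<and>
     openin (subtopology (weil_topology v F) (inertia v F)) (\<Union>U)"
proof -
  let ?L = "\<lambda>U. U \<subseteq> carrier (tame_quotient v F) \<and>
     openin (subtopology (weil_topology v F) (inertia v F)) (\<Union>U)"
  have "istopology ?L"
    unfolding istopology_def
  proof (intro conjI allI impI)
    fix S T assume S: "?L S" and T: "?L T"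
    have "pairwise disjnt (carrier (tame_quotient v F))"
      using group.rcos_disjoint[OF group_inertia subgroup_wild_inertia] by (simp add: FactGroup_def)
    then have "\<Union>(S \<inter> T) = \<Union>S \<inter> \<Union>T"
      using S T unfolding pairwise_def disjnt_def by fast
    then show "S \<inter> T \<subseteq> carrier (tame_quotient v F)"
      "openin (subtopology (weil_topology v F) (inertia v F)) (\<Union>(S \<inter> T))"
      using S T by (auto intro: openin_Int)
  next
    fix K assume K: "\<forall>S\<in>K. ?L S"
    show "\<Union>K \<subseteq> carrier (tame_quotient v F)" using K by blast
    have "openin (subtopology (weil_topology v F) (inertia v F)) (\<Union>S\<in>K. \<Union>S)"
      by (rule openin_Union) (use K in blast)
    moreover have "\<Union>(\<Union>K) = (\<Union>S\<in>K. \<Union>S)" by blast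
    ultimately show "openin (subtopology (weil_topology v F) (inertia v F)) (\<Union>(\<Union>K))" by simp
  qed
  then show ?thesis unfolding tame_topology_def by (simp add: topology_inverse')
qed

lemma inertia_subset_topspace: "inertia v F \<subseteq> topspace (weil_topology v F)"
proof
  fix g assume g: "g \<in> inertia v F"
  \<comment> \<open>The empty set of points to be fixed gives the whole coset of inertia as a
    generating open set.\<close>
  have "g \<in> (\<lambda>h. g \<circ> h) ` {h \<in> inertia v F. \<forall>x\<in>{}. h x = x}"
    using inertia_id by (auto intro!: image_eqI[of _ _ id])
  then show "g \<in> topspace (weil_topology v F)"
    using g inertia_subset_weil unfolding weil_topology_def topology_generated_by_topspace by blast
qed

context
  fixes n :: nat and \<rho> :: "('a \<Rightarrow> 'a) \<Rightarrow> 'k::field mat"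
  assumes smooth: "smooth_rep v F n \<rho>"
begin

lemma rep_mult: "g \<in> weil v F \<Longrightarrow> h \<in> weil v F \<Longrightarrow> \<rho> (g \<circ> h) = \<rho> g * \<rho> h"
  using smooth by (auto simp: smooth_rep_def hom_def automorphism_group_def units_of_def ring_mat_simps)

lemma rep_Units: "g \<in> weil v F \<Longrightarrow> \<rho> g \<in> Units (ring_mat TYPE('k) n ())"
  using smooth by (auto simp: smooth_rep_def hom_def automorphism_group_def units_of_def)

lemma rep_carrier: "g \<in> weil v F \<Longrightarrow> \<rho> g \<in> carrier_mat n n"
  using rep_Units[of g] by (simp add: Units_def ring_mat_simps)

lemma rep_det: "g \<in> weil v F \<Longrightarrow> det (\<rho> g) \<noteq> 0"
  using rep_Units by (rule unit_imp_det_non_zero)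

lemma rep_mult_vec:
  assumes "g \<in> weil v F" "h \<in> weil v F" "x \<in> carrier_vec n"
  shows "\<rho> (g \<circ> h) *\<^sub>v x = \<rho> g *\<^sub>v (\<rho> h *\<^sub>v x)"
  using assms by (simp add: rep_mult assoc_mult_mat_vec[OF rep_carrier rep_carrier])

text \<open>An element \<open>h\<close> of inertia can be moved past \<open>g\<close> at the price
  of conjugating it, and the conjugate is again in inertia.\<close>

lemma invariants_stable:
  assumes g: "g \<in> weil v F" and x: "x \<in> invariants (inertia v F) n \<rho>"
  shows "\<rho> g *\<^sub>v x \<in> invariants (inertia v F) n \<rho>"
proof -
  have xc: "x \<in> carrier_vec n" and fx: "\<And>h. h \<in> inertia v F \<Longrightarrow> \<rho> h *\<^sub>v x = x"
    using x by (auto simp: invariants_def)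
  have "\<rho> h *\<^sub>v (\<rho> g *\<^sub>v x) = \<rho> g *\<^sub>v x" if h: "h \<in> inertia v F" for h
  proof -
    let ?c = "inv_into UNIV g \<circ> h \<circ> g"
    have c: "?c \<in> inertia v F" using g h by (rule inertia_conj)
    have hW: "h \<in> weil v F" and cW: "?c \<in> weil v F" using h c inertia_subset_weil by auto
    have "h \<circ> g = g \<circ> ?c" by (rule ext) (simp add: galois_simps(11)[OF weil_galois[OF g]])
    then have "\<rho> h *\<^sub>v (\<rho> g *\<^sub>v x) = \<rho> g *\<^sub>v (\<rho> ?c *\<^sub>v x)"
      using rep_mult_vec[OF hW g xc] rep_mult_vec[OF g cW xc] by simp
    then show ?thesis using fx[OF c] by simp
  qed
  then show ?thesis using xc rep_carrier[OF g] by (simp add: invariants_def)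
qed

lemma subrep_invariants: "subrep (weil v F) n \<rho> (invariants (inertia v F) n \<rho>)"
proof -
  have carr: "\<rho> h \<in> carrier_mat n n" if "h \<in> inertia v F" for h
    using that rep_carrier inertia_subset_weil by blast
  have "VectorSpace.subspace class_ring (invariants (inertia v F) n \<rho>) (module_vec TYPE('k) n)"
    unfolding subspace_vec_iff invariants_def using carr
    by (auto simp: mult_add_distrib_mat_vec[OF carr] mult_mat_vec[OF carr] mult_mat_vec_zero[OF carr])
  then show ?thesis using invariants_stable by (simp add: subrep_def)
qed

context
  assumes tame: "\<forall>w\<in>wild_inertia v F. \<rho> w = 1\<^sub>m n"
begin

lemma rep_id: "\<rho> id = 1\<^sub>m n"
  using tame by (simp add: wild_inertia_iff inertia_id v_pos)

lemma rep_wild_mult: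
  assumes w: "w \<in> wild_inertia v F" and h: "h \<in> weil v F"
  shows "\<rho> (w \<circ> h) = \<rho> h"
proof -
  have "w \<in> weil v F" using w inertia_subset_weil by (auto simp: wild_inertia_def)
  then show ?thesis using w h tame rep_carrier[OF h] by (simp add: rep_mult left_mult_one_mat)
qed

lemma rep_funpow: "s \<in> inertia v F \<Longrightarrow> \<rho> (s ^^ k) = \<rho> s ^\<^sub>m k"
proof (induction k)
  case 0
  then have "\<rho> s \<in> carrier_mat n n" using rep_carrier inertia_subset_weil by blast
  then show ?case by (simp add: rep_id[unfolded id_def])
next
  case (Suc k)
  have "s \<in> weil v F" "s ^^ k \<in> weil v F"
    using Suc.prems inertia_funpow inertia_subset_weil by blast+
  then have "\<rho> (s ^^ k \<circ> s) = \<rho> (s ^^ k) * \<rho> s" by (intro rep_mult)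
  then show ?case using Suc by (simp only: funpow_Suc_right pow_mat.simps)
qed

text \<open>The cosets all of whose elements fix \<open>u\<close> form a subgroup containing the generator, and \<open>\<rho>\<close>
  takes the value \<open>\<rho> h\<close> on an open set of cosets.\<close>

lemma generator_fixed_imp_inertia_fixed:
  assumes gen: "topological_generator (tame_quotient v F) (tame_topology v F)
      (wild_inertia v F #>\<^bsub>automorphism_group (inertia v F)\<^esub> s)"
    and s: "s \<in> inertia v F" and u: "u \<in> carrier_vec n" "\<rho> s *\<^sub>v u = u" and h: "h \<in> inertia v F"
  shows "\<rho> h *\<^sub>v u = u"
proof -
  let ?I = "automorphism_group (inertia v F)"
  let ?P = "wild_inertia v F"
  let ?G = "tame_quotient v F"
  interpret I: group ?I by (rule group_inertia)
  interpret P: normal ?P ?I by (rule wild_inertia_normal)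
  interpret G: group ?G by (rule P.factorgroup_is_group)
  have carrI: "carrier ?I = inertia v F" by (simp add: automorphism_group_def)
  have coset: "?P #>\<^bsub>?I\<^esub> g = {w \<circ> g |w. w \<in> ?P}" for g
    by (auto simp: r_coset_def automorphism_group_def)
  have self: "g \<in> ?P #>\<^bsub>?I\<^esub> g" if "g \<in> inertia v F" for g
    using I.rcos_self[OF _ subgroup_wild_inertia] that carrI by simp
  have carrG: "carrier ?G = (\<lambda>g. ?P #>\<^bsub>?I\<^esub> g) ` inertia v F"
    by (simp add: carrier_FactGroup carrI)
  \<comment> \<open>Wild elements act trivially, so \<rho> is well defined on the cosets forming the
    tame quotient.\<close>
  have const: "\<rho> g' = \<rho> g" if "g \<in> inertia v F" "g' \<in> ?P #>\<^bsub>?I\<^esub> g" for g g'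
    using that rep_wild_mult inertia_subset_weil by (auto simp: coset)
  have sub_inertia: "C \<subseteq> inertia v F" if "C \<in> carrier ?G" for C
    using P.rcosets_carrier[OF I.is_group, of C] that carrI by (simp add: FactGroup_def)
  define A where "A = {C \<in> carrier ?G. \<forall>g\<in>C. \<rho> g *\<^sub>v u = u}"
  have generate_sub: "C \<in> A" if "C \<in> generate ?G {?P #>\<^bsub>?I\<^esub> s}" for C
    using that
  proof induction
    case one
    have "\<rho> g *\<^sub>v u = u" if "g \<in> ?P" for g using that tame u by simp
    then show ?case using G.one_closed by (simp add: A_def)
  next
    case (incl C)
    then show ?case using const[OF s] s u by (auto simp: A_def carrG)
  next
    case (inv C)
    then have C: "C = ?P #>\<^bsub>?I\<^esub> s" "C \<in> carrier ?G" using s by (auto simp: carrG)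
    have fix_inv: "\<rho> g *\<^sub>v u = u" if g: "g \<in> set_inv\<^bsub>?I\<^esub> C" for g
    proof -
      obtain g' where g': "g' \<in> C" "g = inv\<^bsub>?I\<^esub> g'" using g by (auto simp: SET_INV_def)
      have g'I: "g' \<in> inertia v F" using g' sub_inertia C by blast
      then have gg': "g = inv_into UNIV g'" "g \<in> inertia v F"
        using g' inv_automorphism_group_inertia inertia_inv by auto
      have "g \<circ> g' = id" using galois_simps(12)[OF inertia_galois[OF g'I]] gg' by auto
      moreover have "\<rho> g' *\<^sub>v u = u" using const[OF s] g' C u by simp
      ultimately show ?thesis
        using rep_mult_vec[of g g' u] gg'(2) g'I inertia_subset_weil u by (simp add: rep_id subset_iff)
    qed
    show ?case
      unfolding A_def
    proof (intro CollectI conjI ballI)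
      show "inv\<^bsub>?G\<^esub> C \<in> carrier ?G" by (rule G.inv_closed[OF C(2)])
      show "\<rho> g *\<^sub>v u = u" if "g \<in> inv\<^bsub>?G\<^esub> C" for g
        using fix_inv that by (simp only: P.inv_FactGroup[OF C(2)])
    qed
  next
    case (eng C D)
    then have C: "C \<in> carrier ?G" "\<And>g. g \<in> C \<Longrightarrow> \<rho> g *\<^sub>v u = u"
      and D: "D \<in> carrier ?G" "\<And>g. g \<in> D \<Longrightarrow> \<rho> g *\<^sub>v u = u"
      by (auto simp: A_def)
    have "\<rho> g *\<^sub>v u = u" if g: "g \<in> C \<otimes>\<^bsub>?G\<^esub> D" for g
    proof -
      obtain c d where "c \<in> C" "d \<in> D" "g = c \<circ> d"
        using g by (auto simp: FactGroup_def set_mult_def automorphism_group_def)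
      moreover then have "c \<in> weil v F" "d \<in> weil v F"
        using C D sub_inertia inertia_subset_weil by blast+
      ultimately show ?thesis using C D u by (simp add: rep_mult_vec)
    qed
    then show ?case using G.m_closed[OF C(1) D(1)] by (simp add: A_def)
  qed
  \<comment> \<open>The union of these cosets is the fibre of \<rho> over \<open>\<rho> h\<close>
    inside inertia, which is open because \<rho> is continuous for the discrete topology on its
    target.\<close>
  define U where "U = {C \<in> carrier ?G. \<forall>g\<in>C. \<rho> g = \<rho> h}"
  have "\<Union>U = {g \<in> topspace (weil_topology v F). \<rho> g \<in> {\<rho> h}} \<inter> inertia v F"
  proof
    show "\<Union>U \<subseteq> {g \<in> topspace (weil_topology v F). \<rho> g \<in> {\<rho> h}} \<inter> inertia v F"
      using sub_inertia inertia_subset_topspace by (fastforce simp: U_def)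
    show "{g \<in> topspace (weil_topology v F). \<rho> g \<in> {\<rho> h}} \<inter> inertia v F \<subseteq> \<Union>U"
    proof
      fix g assume "g \<in> {g \<in> topspace (weil_topology v F). \<rho> g \<in> {\<rho> h}} \<inter> inertia v F"
      then have g: "g \<in> inertia v F" "\<rho> g = \<rho> h" by auto
      then have "?P #>\<^bsub>?I\<^esub> g \<in> U" using const[OF g(1)] by (auto simp: U_def carrG)
      then show "g \<in> \<Union>U" using self[OF g(1)] by blast
    qed
  qed
  moreover have "openin (weil_topology v F) {g \<in> topspace (weil_topology v F). \<rho> g \<in> {\<rho> h}}"
  proof (rule openin_continuous_map_preimage)
    show "continuous_map (weil_topology v F) (discrete_topology (carrier (GL TYPE('k) n))) \<rho>"
      using smooth by (simp add: smooth_rep_def)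
    show "openin (discrete_topology (carrier (GL TYPE('k) n))) {\<rho> h}"
      using rep_Units h inertia_subset_weil by (auto simp: units_of_def)
  qed
  ultimately have "openin (tame_topology v F) U"
    unfolding openin_tame_topology openin_subtopology U_def by blast
  moreover have "?P #>\<^bsub>?I\<^esub> h \<in> U" using h const by (auto simp: U_def carrG)
  moreover have "?P #>\<^bsub>?I\<^esub> h \<in> tame_topology v F closure_of generate ?G {?P #>\<^bsub>?I\<^esub> s}"
    using gen h unfolding topological_generator_def by (simp add: carrG)
  \<comment> \<open>\<open>U\<close> is a neighbourhood of the coset of \<open>h\<close>, so by
    density it meets the subgroup generated by \<open>s\<close>. On a common coset \<rho> has the
    value \<open>\<rho> h\<close> and also fixes \<open>u\<close>.\<close>
  ultimately obtain C where "C \<in> generate ?G {?P #>\<^bsub>?I\<^esub> s}" "C \<in> U"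
    unfolding closure_of_def by blast
  then have C: "C \<in> A" "C \<in> U" using generate_sub by auto
  then obtain g where "g \<in> C" using self by (auto simp: A_def carrG)
  then show ?thesis using C by (auto simp: A_def U_def)
qed

end

end

end

theorem theorem6p1:
  fixes p :: nat and v :: "'a::field_char_0 \<Rightarrow> real" and Qp F :: "'a set"
    and n q :: nat and \<rho> :: "('a \<Rightarrow> 'a) \<Rightarrow> 'k::field_char_0 mat"
    and s \<phi> :: "'a \<Rightarrow> 'a" and \<sigma> Fr :: "'k mat"
  assumes F: "padic_field_in_closure p v Qp F"
    and q: "q = residue_card v F"
    and smooth: "smooth_rep v F n \<rho>"
    and semisimple: "semisimple_rep (weil v F) n \<rho>"
    and tame: "\<forall>w\<in>wild_inertia v F. \<rho> w = 1\<^sub>m n"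
    and s: "s \<in> inertia v F"
    and s_generator: "topological_generator (tame_quotient v F) (tame_topology v F)
          (wild_inertia v F #>\<^bsub>automorphism_group (inertia v F)\<^esub> s)"
    and \<phi>: "geometric_frobenius v F \<phi>"
    and \<sigma>: "\<sigma> = \<rho> s"
    and Fr: "Fr = \<rho> \<phi>"
  shows "det (geometric_sum n q \<sigma>) = of_nat q ^ subspace_dim n (invariants (inertia v F) n \<rho>)
    \<and> eval_ratfun (Char Fr) ratfun_X / eval_ratfun (Char (geometric_sum n q \<sigma> * Fr)) ratfun_X
        = L_factor v F \<phi> n \<rho> (of_nat q * ratfun_X) / L_factor v F \<phi> n \<rho> ratfun_X"
proof -
  interpret padic_field_in_closure p v Qp F by (rule F)
  have \<phi>W: "\<phi> \<in> weil v F" and res: "residually_power v q (inv_into UNIV \<phi>)"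
    using \<phi> q by (auto simp: geometric_frobenius_def)
  have sW: "s \<in> weil v F" using s inertia_subset_weil by blast
  have \<sigma>c: "\<sigma> \<in> carrier_mat n n" and Frc: "Fr \<in> carrier_mat n n"
    unfolding \<sigma> Fr using rep_carrier[OF smooth] sW \<phi>W by auto
  have detFr: "det Fr \<noteq> 0" unfolding Fr by (rule rep_det[OF smooth \<phi>W])
  obtain w where w: "w \<in> wild_inertia v F" "s \<circ> \<phi> = \<phi> \<circ> (w \<circ> s ^^ q)"
    using tame_relation[OF s weil_galois[OF \<phi>W] res] by blast
  have comm: "\<sigma> * Fr = Fr * \<sigma> ^\<^sub>m q"
  proof -
    have sq: "s ^^ q \<in> inertia v F" using s by (rule inertia_funpow)
    then have "w \<circ> s ^^ q \<in> inertia v F" using w by (intro inertia_comp) (simp_all add: wild_inertia_def)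
    then have "\<rho> (s \<circ> \<phi>) = Fr * \<rho> (w \<circ> s ^^ q)"
      unfolding w(2) Fr using \<phi>W inertia_subset_weil by (intro rep_mult[OF smooth]) auto
    moreover have "\<rho> (w \<circ> s ^^ q) = \<sigma> ^\<^sub>m q"
      using rep_wild_mult[OF smooth tame w(1)] rep_funpow[OF smooth tame s] sq inertia_subset_weil
      by (auto simp: \<sigma>)
    ultimately show ?thesis using rep_mult[OF smooth sW \<phi>W] by (simp add: \<sigma> Fr)
  qed
  define T where "T = \<sigma> - 1\<^sub>m n"
  have T: "T \<in> carrier_mat n n" using \<sigma>c by (simp add: T_def minus_carrier_mat)
  have T_iff: "T *\<^sub>v x = 0\<^sub>v n \<longleftrightarrow> \<sigma> *\<^sub>v x = x" if "x \<in> carrier_vec n" for x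
    unfolding T_def using \<sigma>c that by (rule minus_one_mat_kernel_iff)
  have Tx: "T *\<^sub>v x = \<sigma> *\<^sub>v x - x" if "x \<in> carrier_vec n" for x
    using \<sigma>c that by (simp add: T_def minus_mult_distrib_mat_vec[of _ n n])
  \<comment> \<open>One inclusion holds because \<open>s\<close> lies in inertia; the other is the
    density argument for the topological generator.\<close>
  have invariants_eq: "invariants (inertia v F) n \<rho> = mat_kernel T"
  proof -
    have "x \<in> invariants (inertia v F) n \<rho> \<longleftrightarrow> x \<in> carrier_vec n \<and> \<sigma> *\<^sub>v x = x" for x
      using generator_fixed_imp_inertia_fixed[OF smooth tame s_generator s] s
      by (auto simp: invariants_def \<sigma>)
    then show ?thesis using T_iff by (auto simp: mat_kernel[OF T])
  qed
  have stable: "T *\<^sub>v u \<in> U" if U: "subrep (weil v F) n \<rho> U" and u: "u \<in> U" for U u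
  proof -
    have uc: "u \<in> carrier_vec n" and \<sigma>u: "\<sigma> *\<^sub>v u \<in> U" and neg: "(-1) \<cdot>\<^sub>v u \<in> U"
      using U u sW by (auto simp: subrep_def subspace_vec_iff \<sigma>)
    then have "\<sigma> *\<^sub>v u + (-1) \<cdot>\<^sub>v u \<in> U" using U by (simp add: subrep_def subspace_vec_iff)
    moreover have "\<sigma> *\<^sub>v u + (-1) \<cdot>\<^sub>v u = T *\<^sub>v u"
      unfolding Tx[OF uc] by (rule eq_vecI) (use \<sigma>c uc in auto)
    ultimately show ?thesis by simp
  qed
  have ker: "\<sigma> *\<^sub>v x = x"
    if x: "x \<in> carrier_vec n" and "\<sigma> *\<^sub>v (\<sigma> *\<^sub>v x - x) = \<sigma> *\<^sub>v x - x" for x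
  proof -
    have TT: "T *\<^sub>v (T *\<^sub>v x) = 0\<^sub>v n"
      using that T_iff[of "T *\<^sub>v x"] mult_mat_vec_carrier[OF T x] by (simp add: Tx)
    \<comment> \<open>The kernel of \<open>T\<close> is stable under all of \<rho>, although
      \<open>T\<close> need not commute with it, because it equals the invariants of the normal
      subgroup inertia.\<close>
    have sub: "subrep (weil v F) n \<rho> {x \<in> carrier_vec n. T *\<^sub>v x = 0\<^sub>v n}"
      using subrep_invariants[OF smooth] unfolding invariants_eq mat_kernel[OF T] .
    have "T *\<^sub>v x = 0\<^sub>v n"
      by (rule semisimple_rep_kernel_square[OF semisimple T _ sub x TT]) (rule stable)
    then show ?thesis using T_iff[OF x] by simp
  qed
  have "Fr *\<^sub>v x \<in> mat_kernel T" if "x \<in> mat_kernel T" for x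
    using invariants_stable[OF smooth \<phi>W] that by (simp add: invariants_eq Fr)
  then obtain bs M where bs: "distinct bs"
      "vectorspace.basis class_ring (subspace_of_vec n (mat_kernel T)) (set bs)"
    and M: "M \<in> carrier_mat (length bs) (length bs)" "Fr * mat_of_cols n bs = mat_of_cols n bs * M"
    and L: "Char_on n Fr (mat_kernel T) = Char M" "subspace_dim n (mat_kernel T) = length bs"
    using Char_on_mat_kernel[OF Frc T] by blast
  obtain e D where D: "D \<in> carrier_mat e e" "Char Fr = Char M * Char D"
      "Char (geometric_sum n q \<sigma> * Fr) = Char (of_nat q \<cdot>\<^sub>m M) * Char D"
    and det: "det (geometric_sum n q \<sigma>) = of_nat q ^ length bs"
    using Char_geometric_sum_frobenius[OF \<sigma>c Frc detFr comm ker bs(1) bs(2)[unfolded T_def] M] by blast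
  interpret ev: comm_ring_hom "\<lambda>P :: 'k poly. eval_ratfun P ratfun_X"
    by (rule comm_ring_hom_eval_ratfun)
  \<comment> \<open>Cancelling this common factor leaves the quotient of \<open>Char M\<close> at X
    and at q X; the inverse in \<open>L_factor\<close> is why the point q X appears in the numerator
    of the final formula.\<close>
  have "Char D \<noteq> 0" using poly_Char_0[OF D(1)] by auto
  then have "eval_ratfun (Char D) ratfun_X \<noteq> 0"
    by (simp add: eval_ratfun_X Zero_fract_def eq_fract)
  then have "eval_ratfun (Char Fr) ratfun_X / eval_ratfun (Char (geometric_sum n q \<sigma> * Fr)) ratfun_X
      = eval_ratfun (Char M) ratfun_X / eval_ratfun (Char M) (of_nat q * ratfun_X)"
    by (simp add: D ev.hom_mult eval_ratfun_Char_smult[OF M(1)])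
  then show ?thesis
    unfolding L_factor_def invariants_eq Fr[symmetric] L using det by (simp add: field_simps)
qed

end
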